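(* Let $n$ be an upper bound on the stream length, given to the algorithm in advance. For any $0<\delta\le0.5$ and $0<\varepsilon\le1$, set $k=2^4\lceil\varepsilon^{-1}\log_2\ln(1/\delta)\rceil$. Then for any fixed item $y$, the Relative-Error Quantiles sketch with parameters $k$ and $n$ computes an estimate $\hat{\operatorname{R}}(y)$ of $\operatorname{R}(y)$ whose error $\mathrm{Err}(y)=\hat{\operatorname{R}}(y)-\operatorname{R}(y)$ satisfies $\Pr[|\mathrm{Err}(y)|\ge\varepsilon\operatorname{R}(y)]<3\delta$. The overall memory used by the algorithm is $O\big(\varepsilon^{-1}\log^2(\varepsilon n)\log\log(1/\delta)\big)$.
   Context: Items come from a totally ordered universe $\mathcal{U}$; $\operatorname{R}(y)$ is the number of stream items $\le y$. A relative-compactor with parameters an even positive integer $k$ and $n$ keeps a buffer of capacity $B=2k\lceil\log_2(n/k)\rceil$ and a state $C$, initially $0$. When an item arrives: if the buffer holds $B$ items, a compaction is performed: let $z(C)$ be the number of trailing ones in the binary representation of $C$, $L=(z(C)+1)k$; the $L$ largest buffer items are sorted and, with probability $1/2$ (independently of everything else), the items at odd positions of this sorted block are output, otherwise those at even positions; these $L$ items are removed from the buffer and $C$ increases by $1$. Then the arriving item is stored. The Relative-Error Quantiles sketch with parameters $k,n$ consists of relative-compactors at levels $0,1,\dots$ with parameters $k,n$: the stream is fed to level $0$ and the output of level $h$ is fed to level $h+1$ (created when level $h$ first outputs). The estimate is $\hat{\operatorname{R}}(y)=\sum_h 2^h\cdot(\text{number of items}\le y\text{ stored in the level-}h\text{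 buffer})$. Memory is measured in words, each storing an item or an $O(\log(n+|\mathcal{U}|))$-bit integer.
   Formalization: The strict error inequality is stated for R(y)>0 (for R(y)=0 the error is always 0, so the printed inequality fails if δ≤1/3); the memory bound assumes k>0, i.e. δ<1/e, and reads log²(εn) as max(1,log₂(εn))², since the printed bound vanishes at εn=1. *)

theory Defs
  imports "HOL-Probability.Probability" "HOL-Library.Monad_Syntax"
begin

(* A relative-compactor: its state C and the contents of its buffer. *)
type_synonym 'a compactor = "nat \<times> 'a multiset"

(* The list is indexed by level and contains exactly the levels created so far. *)
type_synonym 'a sketch = "'a compactor list"

definition trailing_ones :: "nat \<Rightarrow> nat" where
  "trailing_ones c = (LEAST i. \<not> bit c i)"

(* Of type int: the value is not positive when n \<le> k. Such a compactor never outputs anything and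
   simply stores its input. The same happens for k = 0. *)
definition capacity :: "nat \<Rightarrow> nat \<Rightarrow> int" where
  "capacity k n = 2 * int k * \<lceil>log 2 (real n / real k)\<rceil>"

definition empty_compactor :: "'a compactor" where
  "empty_compactor = (0, {#})"

(* The result consists of the compactor after the compaction and of the output, in increasing order.
   List positions are counted from 0, so "even i" selects the 1st, 3rd, 5th, ... item. *)
definition compact :: "nat \<Rightarrow> 'a::linorder compactor \<Rightarrow> ('a compactor \<times> 'a list) pmf" where
  "compact k c = (case c of (C, b) \<Rightarrow>
     let s = sorted_list_of_multiset b;
         L = (trailing_ones C + 1) * k;
         keep = take (length s - L) s;
         block = drop (length s - L) s
     in do {
       coin \<leftarrow> bernoulli_pmf (1/2);
       return_pmf ((Suc C, mset keep), nths block {i. if coin then even i else odd i})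
     })"

definition compactor_insert ::
    "nat \<Rightarrow> nat \<Rightarrow> 'a::linorder \<Rightarrow> 'a compactor \<Rightarrow> ('a compactor \<times> 'a list) pmf" where
  "compactor_insert k n x c = do {
     ((C, b), out) \<leftarrow>
       (if int (size (snd c)) = capacity k n then compact k c else return_pmf (c, []));
     return_pmf ((C, add_mset x b), out)
   }"

fun compactor_feed ::
    "nat \<Rightarrow> nat \<Rightarrow> 'a::linorder list \<Rightarrow> 'a compactor \<Rightarrow> ('a compactor \<times> 'a list) pmf" where
  "compactor_feed k n [] c = return_pmf (c, [])"
| "compactor_feed k n (x # xs) c = do {
     (c', out) \<leftarrow> compactor_insert k n x c;
     (c'', out') \<leftarrow> compactor_feed k n xs c';
     return_pmf (c'', out @ out')
   }"

lemma compact_size: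
  assumes "((C', b'), out) \<in> set_pmf (compact k (C, b))"
  shows "size b' + length out \<le> size b"
proof -
  define s where "s = sorted_list_of_multiset b"
  have s: "length s = size b"
    unfolding s_def by (metis mset_sorted_list_of_multiset size_mset)
  define m where "m = length s - (trailing_ones C + 1) * k"
  obtain P where P: "b' = mset (take m s)" "out = nths (drop m s) P"
    using assms unfolding compact_def Let_def by (auto simp: s_def m_def)
  have "length out \<le> length (drop m s)"
    unfolding P(2) length_nths
    by (rule order_trans[OF card_mono[of "{..<length (drop m s)}"]]) auto
  moreover have "size b' = min (length s) m" by (simp add: P(1))
  ultimately show ?thesis using s by auto
qed

lemma compactor_insert_size:
  assumes "(c', out) \<in> set_pmf (compactor_insert k n x c)"
  shows "size (snd c') + length out \<le> Suc (size (snd c))" "snd c' \<noteq> {#}"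
  using assms compact_size[of _ _ _ k "fst c" "snd c"]
  unfolding compactor_insert_def by (fastforce split: if_splits prod.splits)+

lemma compactor_feed_size:
  "(c', out) \<in> set_pmf (compactor_feed k n xs c) \<Longrightarrow>
     size (snd c') + length out \<le> length xs + size (snd c) \<and> (xs \<noteq> [] \<longrightarrow> snd c' \<noteq> {#})"
proof (induction xs arbitrary: c c' out)
  case Nil
  then show ?case by simp
next
  case (Cons x xs)
  then obtain c1 o1 o2 where
    1: "(c1, o1) \<in> set_pmf (compactor_insert k n x c)" and
    2: "(c', o2) \<in> set_pmf (compactor_feed k n xs c1)" and out: "out = o1 @ o2"
    by (fastforce split: prod.splits)
  have "snd c' \<noteq> {#}"
    using Cons.IH[OF 2] compactor_insert_size(2)[OF 1] 2 by (cases xs) auto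
  then show ?case
    using compactor_insert_size(1)[OF 1] Cons.IH[OF 2] by (simp add: out)
qed

(* Feeds a list of items to the lowest of the given levels, and its output to the levels above it.
   A level that does not exist yet is created only if it receives an item. *)
function sketch_feed ::
    "nat \<Rightarrow> nat \<Rightarrow> 'a::linorder list \<Rightarrow> 'a sketch \<Rightarrow> 'a sketch pmf" where
  "sketch_feed k n xs cs =
     (if xs = [] then return_pmf cs
      else do {
        (c, out) \<leftarrow> compactor_feed k n xs (case cs of [] \<Rightarrow> empty_compactor | c # _ \<Rightarrow> c);
        cs' \<leftarrow> sketch_feed k n out (tl cs);
        return_pmf (c # cs')
      })"
  by pat_completeness auto
termination
proof (relation "measures [\<lambda>(k, n, xs, cs). length cs, \<lambda>(k, n, xs, cs). length xs]")
  fix k n :: nat and xs :: "'a::linorder list" and cs :: "'a sketch" and z c out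
  assume "xs \<noteq> []" "z \<in> set_pmf (compactor_feed k n xs (case cs of [] \<Rightarrow> empty_compactor | c # _ \<Rightarrow> c))"
    "(c, out) = z"
  then show "((k, n, out, tl cs), (k, n, xs, cs)) \<in>
      measures [\<lambda>(k, n, xs, cs). length cs, \<lambda>(k, n, xs, cs). length xs]"
    using compactor_feed_size[of c out k n xs "case cs of [] \<Rightarrow> empty_compactor | c # _ \<Rightarrow> c"]
    by (cases cs) (auto simp: empty_compactor_def nonempty_has_size)
qed simp

declare sketch_feed.simps [simp del]

fun process_stream ::
    "nat \<Rightarrow> nat \<Rightarrow> 'a::linorder list \<Rightarrow> 'a sketch \<Rightarrow> 'a sketch pmf" where
  "process_stream k n [] cs = return_pmf cs"
| "process_stream k n (x # xs) cs = do {
     cs' \<leftarrow> sketch_feed k n [x] cs;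
     process_stream k n xs cs'
   }"

definition req_sketch :: "nat \<Rightarrow> nat \<Rightarrow> 'a::linorder list \<Rightarrow> 'a sketch pmf" where
  "req_sketch k n xs = process_stream k n xs [empty_compactor]"

definition item_rank :: "'a::linorder list \<Rightarrow> 'a \<Rightarrow> nat" where
  "item_rank xs y = length (filter (\<lambda>x. x \<le> y) xs)"

definition estimate :: "'a::linorder sketch \<Rightarrow> 'a \<Rightarrow> nat" where
  "estimate cs y = (\<Sum>h<length cs. 2 ^ h * size (filter_mset (\<lambda>x. x \<le> y) (snd (cs ! h))))"

definition Err :: "'a::linorder list \<Rightarrow> 'a \<Rightarrow> 'a sketch \<Rightarrow> real" where
  "Err xs y cs = real (estimate cs y) - real (item_rank xs y)"

(* Two words for k and n, and for every level one word for C and the words reserved for the buffer: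
   its full capacity, even if fewer items are currently stored. *)
definition memory_words :: "nat \<Rightarrow> nat \<Rightarrow> 'a sketch \<Rightarrow> nat" where
  "memory_words k n cs = 2 + (\<Sum>(C, b)\<leftarrow>cs. 1 + nat (max (capacity k n) (int (size b))))"

(* This is 0 exactly if ln (1 / \<delta>) \<le> 1 (for 0 < \<epsilon>). *)
definition req_k :: "real \<Rightarrow> real \<Rightarrow> nat" where
  "req_k \<epsilon> \<delta> = 2 ^ 4 * nat \<lceil>(1 / \<epsilon>) * log 2 (ln (1 / \<delta>))\<rceil>"

end

theory Submission
  imports Defs
begin

text \<open>
  Only the items \<open>\<le> y\<close> of the input of a level matter, say \<open>r\<close> of them. A compaction changes
  the weighted count of these items by a fair random sign, or not at all, and it can do so only if
  the compacted block contains such an item. By the schedule of trailing ones, each of these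
  important compactions can be charged to \<open>k\<close> items \<open>\<le> y\<close> of its own, so there are at most
  \<open>r / k\<close> of them.

  A stream may be processed level by level. The error of the lower levels is controlled by a
  backward recursion on the moment generating function: since the weighted count arriving at level
  \<open>h\<close> is at most the rank plus the error \<open>M\<close> made below, averaging
  \<open>exp (\<theta> (R + M))\<close> over level \<open>h\<close> only replaces \<open>\<theta>\<close> by
  \<open>\<theta> + \<theta>\<^sup>2 2\<^sup>h / (2 k)\<close>. The last \<open>\<lfloor>log\<^sub>2 ln (1 / \<delta>)\<rfloor>\<close> levels at which
  important compactions occur are estimated deterministically; each contributes at most about
  \<open>R / k\<close>. For \<open>\<delta> > 1 / 3\<close> the probability bound is trivial.
\<close>

section \<open>Compactions and trailing ones\<close>

text \<open>The number of important compactions at a level is itself random, because it depends on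
  the errors made below. Carrying \<open>R + M\<close> in the exponent settles this: the same
  quantity holds the accumulated error and bounds the rank that the next level sees. A compaction at
  level h enters the variance with weight 4^h, against at most about 2^(-h) R / k important
  compactions. So the variance bound doubles from level to level and the highest levels dominate.
  Treating the last J of them deterministically gains a factor 2^J, of order ln (1 / \<delta>), in
  the exponent and costs about J R / k, which is about \<epsilon> R / 16 at most by the choice of k.
  What remains is an exponent of order (\<epsilon> k)^2 2^J, so it suffices that k grows like log
  log (1 / \<delta>). For \<delta> \<ge> 1 / e the parameter k would be 0. The threshold 1 / 3 keeps
  log2 ln (1 / \<delta>) away from 0, and near it the gap between the factor 2 of the two tails and
  the factor 3 of the claim is really used.\<close>

lemma trailing_ones_spec:
  "\<not> bit c (trailing_ones c)" "i < trailing_ones c \<Longrightarrow> bit c i"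
proof -
  have "\<exists>i. \<not> bit c i"
    by (metis bit_nat_def div_less dvd_0_right less_exp)
  then show "\<not> bit c (trailing_ones c)"
    unfolding trailing_ones_def by (rule LeastI_ex)
  show "i < trailing_ones c \<Longrightarrow> bit c i"
    unfolding trailing_ones_def using not_less_Least by blast
qed

lemma bit_Suc_aux:
  fixes c :: nat
  shows "(\<forall>i<z. bit c i) \<Longrightarrow> \<not> bit c z \<Longrightarrow> bit (Suc c) i \<longleftrightarrow> i = z \<or> z < i \<and> bit c i"
proof (induction z arbitrary: c i)
  case 0
  then show ?case by (cases i) (auto simp: bit_0 bit_Suc)
next
  case (Suc z)
  have odd: "odd c" using Suc.prems(1) by (auto simp: bit_0)
  have "\<forall>i<z. bit (c div 2) i" "\<not> bit (c div 2) z"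
    using Suc.prems by (auto simp: bit_Suc)
  note IH = Suc.IH[OF this]
  have "Suc c div 2 = Suc (c div 2)" using odd by presburger
  then show ?case using odd IH by (cases i) (auto simp: bit_0 bit_Suc)
qed

text \<open>The carry of a binary increment clears the trailing ones and sets the bit above them.
  Read as bookkeeping: a compaction of \<open>trailing_ones C + 1\<close> sections erases the marks
  of the shorter compactions and sets its own.\<close>

lemma bit_Suc_trailing_ones:
  "bit (Suc c) i \<longleftrightarrow> i = trailing_ones c \<or> trailing_ones c < i \<and> bit c i"
  by (rule bit_Suc_aux) (auto simp: trailing_ones_spec)

lemma trailing_ones_less:
  assumes "Suc c < 2 ^ m" shows "trailing_ones c < m"
proof (rule ccontr)
  assume "\<not> trailing_ones c < m"
  then have "take_bit m c = mask m"
    by (intro bit_eqI) (auto simp: bit_take_bit_iff bit_mask_iff trailing_ones_spec)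
  then have "mask m \<le> c" by (metis take_bit_nat_less_eq_self)
  then show False using assms by (simp add: mask_eq_exp_minus_1)
qed

lemma finite_bits: "finite {i. bit (c::nat) i \<and> P i}"
proof (rule finite_subset)
  show "{i. bit c i \<and> P i} \<subseteq> {..<c}"
  proof clarsimp
    fix i assume "bit c i"
    then have "2 ^ i \<le> c" by (metis bit_nat_def div_less dvd_0_right not_less)
    then show "i < c" using less_exp[of i] by linarith
  qed
qed simp

lemma bit_less: "bit (c::nat) i \<Longrightarrow> c < 2 ^ m \<Longrightarrow> i < m"
  by (metis bit_nat_def div_less dvd_0_right not_less order_less_le_trans power_increasing one_le_numeral)

section \<open>Ranks in sorted lists and the effect of one compaction on them\<close>

abbreviation low :: "'a::linorder \<Rightarrow> 'a multiset \<Rightarrow> nat" where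
  "low y b \<equiv> size (filter_mset (\<lambda>x. x \<le> y) b)"

lemma item_rank_simps [simp]:
  "item_rank [] y = 0"
  "item_rank (x # xs) y = of_bool (x \<le> y) + item_rank xs y"
  "item_rank (xs @ ys) y = item_rank xs y + item_rank ys y"
  by (auto simp: item_rank_def)

lemma low_mset: "low y (mset xs) = item_rank xs y"
  unfolding item_rank_def by (metis mset_filter size_mset)

lemma length_nths_parity:
  "length (nths l {i. even i}) = (length l + 1) div 2"
  "length (nths l {i. odd i}) = length l div 2"
  by (induction l) (auto simp: nths_Cons)

text \<open>The items \<le> y form a prefix of a sorted list, so a selection of positions can be
  restricted to that prefix without renumbering.\<close>

lemma item_rank_nths:
  "sorted l \<Longrightarrow> item_rank (nths l P) y = length (nths (filter (\<lambda>x. x \<le> y) l) P)"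
proof (induction l arbitrary: P)
  case (Cons x l)
  show ?case
  proof (cases "x \<le> y")
    case True
    with Cons show ?thesis by (auto simp: nths_Cons)
  next
    case False
    then have "filter (\<lambda>x. x \<le> y) (x # l) = []"
      using Cons.prems by (force simp: filter_empty_conv)
    moreover have "filter (\<lambda>x. x \<le> y) (nths (x # l) P) = []"
      using False Cons.prems by (force simp: filter_empty_conv dest!: in_set_nthsD)
    ultimately show ?thesis by (simp add: item_rank_def)
  qed
qed simp

lemma item_rank_take:
  "sorted l \<Longrightarrow> item_rank (take j l) y = min j (item_rank l y)"
proof (induction l arbitrary: j)
  case (Cons x l)
  show ?case
  proof (cases "x \<le> y")
    case True
    with Cons show ?thesis by (cases j) auto
  next
    case False
    then have "\<forall>z\<in>set (x # l). \<not> z \<le> y"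
      using Cons.prems by force
    then have "item_rank (x # l) y = 0" "item_rank (take j (x # l)) y = 0"
      by (metis (no_types, lifting) filter_False in_set_takeD item_rank_def list.size(3))+
    then show ?thesis by simp
  qed
qed simp

text \<open>The kept items are the smallest ones, hence the minimum. The q items \<le> y of the
  block occupy its first positions, so the two possible outputs contain q / 2 of them, rounded up or
  down. Only an odd q makes a difference.\<close>

lemma compact_eq:
  fixes b :: "'a::linorder multiset"
  assumes "L = (trailing_ones C + 1) * k" "L \<le> size b" "even L"
  obtains b' o1 o2 where
    "compact k (C, b) = do {coin \<leftarrow> bernoulli_pmf (1/2);
       return_pmf ((Suc C, b'), if coin then o1 else o2)}"
    "size b' = size b - L" "2 * length o1 = L" "2 * length o2 = L"
    "\<And>y. low y b' = min (size b - L) (low y b)"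
    "\<And>y. item_rank o1 y = (low y b - low y b' + 1) div 2"
    "\<And>y. item_rank o2 y = (low y b - low y b') div 2"
proof -
  define s where "s = sorted_list_of_multiset b"
  have ms: "mset s = b" and ss: "sorted s" by (auto simp: s_def)
  have len: "length s = size b" using ms by auto
  define keep where "keep = take (length s - L) s"
  define block where "block = drop (length s - L) s"
  have lb: "length block = L" using assms len by (simp add: block_def)
  have sb: "sorted block" using ss by (simp add: block_def sorted_wrt_drop)
  have lk: "low y (mset keep) = min (size b - L) (low y b)" for y
    using item_rank_take[OF ss, of "length s - L" y] low_mset[of y s] ms len
    by (simp add: low_mset keep_def)
  have "s = keep @ block" by (simp add: keep_def block_def)
  then have "item_rank s y = item_rank keep y + item_rank block y" for y by simp
  then have rb: "item_rank block y = low y b - low y (mset keep)" for y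
    using low_mset[of y s] ms by (simp add: low_mset)
  show ?thesis
  proof (rule that[of "mset keep" "nths block {i. even i}" "nths block {i. odd i}"])
    show "compact k (C, b) = do {coin \<leftarrow> bernoulli_pmf (1/2);
       return_pmf ((Suc C, mset keep), if coin then nths block {i. even i} else nths block {i. odd i})}"
      unfolding compact_def Let_def
      by (auto simp: s_def[symmetric] keep_def block_def assms(1) intro!: bind_pmf_cong)
    show "size (mset keep) = size b - L" using assms len by (simp add: keep_def)
    show "2 * length (nths block {i. even i}) = L" "2 * length (nths block {i. odd i}) = L"
      using lb assms(3) by (auto simp: length_nths_parity)
    show "low y (mset keep) = min (size b - L) (low y b)" for y by (rule lk)
    show "item_rank (nths block {i. even i}) y = (low y b - low y (mset keep) + 1) div 2"
      "item_rank (nths block {i. odd i}) y = (low y b - low y (mset keep)) div 2" for y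
      unfolding item_rank_nths[OF sb] length_nths_parity by (simp_all add: rb flip: item_rank_def)
  qed
qed

section \<open>The charging argument\<close>

lemma compactor_insert_simps:
  "compactor_insert k n x (C, b) =
     (if int (size b) = capacity k n
      then do {((C', b'), out) \<leftarrow> compact k (C, b); return_pmf ((C', add_mset x b'), out)}
      else return_pmf ((C, add_mset x b), []))"
  unfolding compactor_insert_def by (auto simp: bind_return_pmf split: prod.splits)

lemma low_le_size: "low y b \<le> size b"
  by (rule size_mset_mono) (rule multiset_filter_subset)

text \<open>The regime in which buffers have positive capacity; m stands for the rounded-up
  logarithm of n / k. Through \<open>n_le\<close> the state stays below 2^m, so a compaction never
  touches more than half of the buffer.\<close>

locale compactor_params =
  fixes k n m :: nat
  assumes k_pos: "0 < k" and k_even: "even k" and m_pos: "0 < m"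
    and capacity: "capacity k n = 2 * int k * int m" and n_le: "n \<le> k * 2 ^ m"
begin

text \<open>
  Sections of \<open>k\<close> items are counted from the large end of the full buffer, starting with 0. Bit
  \<open>i\<close> of \<open>C\<close> is set iff the last compaction of more than \<open>i\<close> sections removed exactly the
  sections \<open>0..i\<close>; if it was important, then it is charged to section \<open>i + 1\<close>, which consists of
  items \<open>\<le> y\<close>. The potential \<open>pot C r\<close> counts the items \<open>\<le> y\<close> in the buffer outside these
  sections; treating a full section \<open>i + 1\<close> as charged even after an unimportant compaction makes it
  a function of \<open>C\<close> and the number \<open>r\<close> of such items alone.
\<close>

definition full_sections :: "nat \<Rightarrow> nat \<Rightarrow> nat set" where
  "full_sections C r = {i. bit C i \<and> 2 * k * m \<le> r + (i + 1) * k}"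

definition pot :: "nat \<Rightarrow> nat \<Rightarrow> int" where
  "pot C r = int r - int k * int (card (full_sections C r))"

lemma finite_full_sections [simp]: "finite (full_sections C r)"
  unfolding full_sections_def by (rule finite_bits)

lemma pot_0 [simp]: "pot 0 r = int r"
  by (simp add: pot_def full_sections_def)

text \<open>A charged section belongs to a bit below m, which forces r to be at least k m, and there
  are at most m such bits to pay for.\<close>

lemma pot_nonneg:
  assumes "C < 2 ^ m"
  shows "0 \<le> pot C r"
proof (cases "full_sections C r = {}")
  case False
  have sub: "full_sections C r \<subseteq> {..<m}"
    using assms by (auto simp: full_sections_def bit_less)
  then have "card (full_sections C r) \<le> m"
    by (metis card_lessThan card_mono finite_lessThan)
  then have "k * card (full_sections C r) \<le> k * m" by simp
  also obtain i where i: "i < m" "2 * k * m \<le> r + (i + 1) * k"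
    using False sub by (auto simp: full_sections_def)
  then have "(i + 1) * k \<le> m * k" by (intro mult_right_mono) auto
  then have "k * m \<le> r" using i(2) by (simp add: algebra_simps)
  finally show ?thesis unfolding pot_def by (metis diff_ge_0_iff_ge of_nat_le_iff of_nat_mult)
qed (simp add: pot_def)

lemma pot_add:
  assumes "r \<le> r'"
  shows "pot C r' \<le> pot C r + int (r' - r)"
proof -
  have "card (full_sections C r) \<le> card (full_sections C r')"
    using assms by (intro card_mono finite_full_sections) (auto simp: full_sections_def)
  then have "int k * int (card (full_sections C r)) \<le> int k * int (card (full_sections C r'))"
    by (intro mult_left_mono) auto
  then show ?thesis using assms unfolding pot_def by linarith
qed

text \<open>Here T is the number of kept items. The sections released by clearing the bits below z
  lie inside the removed block and consist of items \<le> y, so their k items each leave together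
  with the charge. An important compaction, T < r, charges the section just below the block, which
  exists in full among the kept items.\<close>

lemma pot_compact:
  fixes C r :: nat
  defines "z \<equiv> trailing_ones C"
  assumes "Suc z \<le> 2 * m" and r: "r \<le> 2 * k * m"
  defines "T \<equiv> 2 * k * m - (z + 1) * k"
  shows "pot (Suc C) (min T r) + int k * of_bool (T < r) \<le> pot C r"
proof -
  define A where "A = {i. bit C i \<and> z < i \<and> 2 * k * m \<le> r + (i + 1) * k}"
  have finA: "finite A"
    by (rule finite_subset[OF _ finite_full_sections[of C r]]) (auto simp: A_def full_sections_def)
  have zk: "(z + 1) * k \<le> 2 * k * m"
    using mult_le_mono1[OF assms(2), of k] by (simp add: algebra_simps)
  have T: "T + (z + 1) * k = 2 * k * m" using zk by (simp add: T_def)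
  have mon: "(i + 1) * k + k \<le> (j + 1) * k" if "i < j" for i j
    using mult_le_mono1[of "Suc i + 1" "j + 1" k] that by (simp add: algebra_simps)
  have A_eq: "{i. bit C i \<and> z < i \<and> 2 * k * m \<le> min T r + (i + 1) * k} = A"
  proof -
    \<comment> \<open>Since T + (z + 1) k = 2 k m, the value T already passes the test for every i >
      z, so cutting r down to T changes nothing for the higher bits.\<close>
    have "2 * k * m \<le> min T r + (i + 1) * k \<longleftrightarrow> 2 * k * m \<le> r + (i + 1) * k" if "z < i" for i
      using mon[OF that] T by (auto simp: min_def)
    then show ?thesis unfolding A_def by blast
  qed
  have after: "full_sections (Suc C) (min T r) = (if T \<le> r then insert z A else A)"
    unfolding full_sections_def bit_Suc_trailing_ones z_def[symmetric] A_eq[symmetric]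
    using T by (auto simp: min_def)
  have zA: "z \<notin> A" by (simp add: A_def)
  define Z where "Z = {i. i < z \<and> 2 * k * m \<le> r + (i + 1) * k}"
  have before: "full_sections C r = Z \<union> A"
  proof -
    have "bit C i \<longleftrightarrow> i < z \<or> z < i \<and> bit C i" for i
      using trailing_ones_spec by (metis linorder_neqE_nat z_def)
    then show ?thesis unfolding full_sections_def A_def Z_def by blast
  qed
  have disj: "Z \<inter> A = {}" by (auto simp: Z_def A_def)
  have finZ: "finite Z" by (simp add: Z_def)
  have card: "card (full_sections C r) = card Z + card A"
    unfolding before using finZ finA disj by (rule card_Un_disjoint)
  have Z_le: "int k * int (card Z) \<le> int r - int T" if "T < r"
  proof (cases "Z = {}")
    case False
    define i0 where "i0 = Min Z"
    have i0: "i0 \<in> Z" using finZ False by (simp add: i0_def)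
    have "Z \<subseteq> {i0..<z}" using finZ by (auto simp: i0_def Z_def)
    then have "card Z \<le> z - i0" by (metis card_atLeastLessThan card_mono finite_atLeastLessThan)
    then have "k * card Z \<le> k * (z - i0)" by (rule mult_le_mono2)
    moreover have "2 * k * m \<le> r + (i0 + 1) * k" using i0 by (simp add: Z_def)
    moreover have "k * (z - i0) + (i0 + 1) * k = (z + 1) * k"
      using i0 by (auto simp: Z_def algebra_simps simp flip: add_mult_distrib2)
    ultimately have "T + k * card Z \<le> r" using T by linarith
    then show ?thesis using of_nat_le_iff[of "T + k * card Z" r, where ?'a = int] by simp
  qed (use that in simp)
  show ?thesis
  proof (cases "T < r")
    case True
    then show ?thesis using Z_le after zA finA card by (simp add: pot_def algebra_simps)
  next
    \<comment> \<open>The block contains no item \<le> y, so no bit below z can be charged. If T =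
      r, bit z is charged although nothing important happened, which only lowers the
      potential.\<close>
    case False
    have "\<not> 2 * k * m \<le> r + (i + 1) * k" if "i < z" for i
      using mon[OF that] T k_pos False by linarith
    then have "Z = {}" by (auto simp: Z_def)
    then show ?thesis using False after zA finA card by (auto simp: pot_def algebra_simps)
  qed
qed

text \<open>The output is \<open>o1\<close> or \<open>o2\<close>, \<open>d\<close> is the parity of the number of items \<open>\<le> y\<close> in the block.\<close>

lemma insert_cases:
  fixes x :: "'a::linorder"
  assumes inv: "C * k + size b + 1 \<le> n" "size b \<le> 2 * k * m"
  obtains C' b' o1 o2 where
    "compactor_insert k n x (C, b) = do {coin \<leftarrow> bernoulli_pmf (1/2);
       return_pmf ((C', b'), if coin then o1 else o2)}"
    "C' * k + size b' \<le> C * k + size b + 1"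
    "size b' \<le> 2 * k * m"
    "C < 2 ^ m \<Longrightarrow> C' < 2 ^ m"
    "\<And>out. out \<in> {o1, o2} \<Longrightarrow> size b' + 2 * length out = size b + 1"
    "size b < 2 * k * m \<Longrightarrow> o1 = [] \<and> o2 = []"
    "\<And>y. \<exists>d\<in>{0, 1}.
       2 * int (item_rank o1 y) + int (low y b') = of_bool (x \<le> y) + int (low y b) + d \<and>
       2 * int (item_rank o2 y) + int (low y b') = of_bool (x \<le> y) + int (low y b) - d \<and>
       int k * d + pot C' (low y b') \<le> pot C (low y b) + of_bool (x \<le> y)"
    "\<And>y. low y b \<le> k * m \<Longrightarrow> item_rank o1 y = 0 \<and> item_rank o2 y = 0"
proof (cases "size b = 2 * k * m")
  case False
  then have eq: "compactor_insert k n x (C, b) = return_pmf ((C, add_mset x b), [])"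
    using capacity by (simp add: compactor_insert_simps) (metis of_nat_eq_iff of_nat_mult of_nat_numeral)
  show ?thesis
  proof (rule that[of C "add_mset x b" "[]" "[]"])
    show "compactor_insert k n x (C, b) = do {coin \<leftarrow> bernoulli_pmf (1/2);
       return_pmf ((C, add_mset x b), if coin then [] else [])}"
      by (simp add: eq)
    fix y
    show "\<exists>d\<in>{0, 1}.
       2 * int (item_rank [] y) + int (low y (add_mset x b)) = of_bool (x \<le> y) + int (low y b) + d \<and>
       2 * int (item_rank [] y) + int (low y (add_mset x b)) = of_bool (x \<le> y) + int (low y b) - d \<and>
       int k * d + pot C (low y (add_mset x b)) \<le> pot C (low y b) + of_bool (x \<le> y)"
      using pot_add[of "low y b" "Suc (low y b)" C] by (intro bexI[of _ 0]) auto
  qed (use inv False in auto)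
next
  case True
  define L where "L = (trailing_ones C + 1) * k"
  \<comment> \<open>Each compaction removes at least k items, so C k plus the buffer size is at most
    the number of items received. With a full buffer this leaves C + 2 m < 2^m, hence fewer than m
    trailing ones and a block of at most k m items.\<close>
  have "C * k + 2 * k * m + 1 \<le> k * 2 ^ m" using inv True n_le by linarith
  then have "k * (C + 2 * m) < k * 2 ^ m" by (simp add: algebra_simps)
  then have C: "Suc C < 2 ^ m" using m_pos by auto
  then have z: "trailing_ones C < m" by (rule trailing_ones_less)
  then have L_le: "L \<le> k * m" using mult_le_mono1[of "trailing_ones C + 1" m k]
    by (simp add: L_def algebra_simps)
  have k_L: "k \<le> L" by (simp add: L_def)
  have L2: "L \<le> size b" using L_le True by linarith
  obtain b' o1 o2 where comp:
    "compact k (C, b) = do {coin \<leftarrow> bernoulli_pmf (1/2);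
       return_pmf ((Suc C, b'), if coin then o1 else o2)}"
    "size b' = size b - L" "2 * length o1 = L" "2 * length o2 = L"
    "\<And>y. low y b' = min (size b - L) (low y b)"
    "\<And>y. item_rank o1 y = (low y b - low y b' + 1) div 2"
    "\<And>y. item_rank o2 y = (low y b - low y b') div 2"
    using compact_eq[OF L_def L2] k_even by (auto simp: L_def)
  show ?thesis
  proof (rule that[of "Suc C" "add_mset x b'" o1 o2])
    show "compactor_insert k n x (C, b) = do {coin \<leftarrow> bernoulli_pmf (1/2);
       return_pmf ((Suc C, add_mset x b'), if coin then o1 else o2)}"
      using True capacity by (simp add: compactor_insert_simps comp(1) bind_assoc_pmf bind_return_pmf)
    show "Suc C * k + size (add_mset x b') \<le> C * k + size b + 1"
      using comp(2) k_L L2 by simp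
    show "size (add_mset x b') \<le> 2 * k * m"
      using comp(2) k_L L2 k_pos True by simp
    show "Suc C < 2 ^ m" by (rule C)
    show "size (add_mset x b') + 2 * length out = size b + 1" if "out \<in> {o1, o2}" for out
      using that comp(2,3,4) L2 by auto
    show "o1 = [] \<and> o2 = []" if "size b < 2 * k * m" using that True by simp
    show "item_rank o1 y = 0 \<and> item_rank o2 y = 0" if "low y b \<le> k * m" for y
      using comp(5)[of y] that L_le True by (simp add: comp(6,7))
    fix y
    define q where "q = low y b - low y b'"
    have lb': "low y b' + q = low y b" by (simp add: q_def comp(5))
    define d where "d = int (q mod 2)"
    have d01: "d \<in> {0, 1}" by (auto simp: d_def)
    have o1: "2 * int (item_rank o1 y) = int q + d"
      unfolding comp(6) q_def[symmetric] d_def by (simp add: mod2_eq_if) presburger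
    have o2: "2 * int (item_rank o2 y) = int q - d"
      unfolding comp(7) q_def[symmetric] d_def by (simp add: mod2_eq_if) presburger
    have "low y b \<le> 2 * k * m" using low_le_size[of y b] True by simp
    from pot_compact[of C, OF _ this] z
    have "pot (Suc C) (low y b') + int k * of_bool (size b - L < low y b) \<le> pot C (low y b)"
      unfolding comp(5) True L_def by simp
    \<comment> \<open>An odd number of items \<le> y in the block is not 0, so the compaction is
      important and the potential has dropped by k.\<close>
    moreover have "int k * d \<le> int k * of_bool (size b - L < low y b)"
      using d01 by (intro mult_left_mono) (auto simp: d_def q_def comp(5))
    moreover have "pot (Suc C) (low y (add_mset x b')) \<le> pot (Suc C) (low y b') + of_bool (x \<le> y)"
      using pot_add[of "low y b'" "Suc (low y b')" "Suc C"] by auto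
    ultimately have le: "int k * d + pot (Suc C) (low y (add_mset x b')) \<le> pot C (low y b) + of_bool (x \<le> y)"
      by (smt (verit))
    have s1: "int (low y (add_mset x b')) = of_bool (x \<le> y) + int (low y b')" by simp
    have s2: "int (low y b') + int q = int (low y b)" using lb' by (metis of_nat_add)
    show "\<exists>d\<in>{0, 1}.
       2 * int (item_rank o1 y) + int (low y (add_mset x b')) = of_bool (x \<le> y) + int (low y b) + d \<and>
       2 * int (item_rank o2 y) + int (low y (add_mset x b')) = of_bool (x \<le> y) + int (low y b) - d \<and>
       int k * d + pot (Suc C) (low y (add_mset x b')) \<le> pot C (low y b) + of_bool (x \<le> y)"
    proof (intro bexI[of _ d] conjI)
      show "2 * int (item_rank o1 y) + int (low y (add_mset x b')) = of_bool (x \<le> y) + int (low y b) + d"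
        unfolding o1 s1 using s2 by simp
      show "2 * int (item_rank o2 y) + int (low y (add_mset x b')) = of_bool (x \<le> y) + int (low y b) - d"
        unfolding o2 s1 using s2 by simp
    qed (fact le d01)+
  qed
qed

end

section \<open>One level of the sketch\<close>

text \<open>Hoeffding's lemma for a fair sign, taken from its auxiliary inequality with p = 1 / 2
  and h = 2 x, then multiplied by exp (-x). That inequality is for nonnegative h; the left side is
  even in x.\<close>

lemma cosh_le_exp_square: "(exp x + exp (- x)) / 2 \<le> exp (x\<^sup>2 / 2)" for x :: real
proof -
  have *: "(exp x + exp (- x)) / 2 \<le> exp (x\<^sup>2 / 2)" if "0 \<le> x" for x :: real
  proof -
    have "- (2 * x) * (1 / 2) + ln (1 + 1 / 2 * (exp (2 * x) - 1)) \<le> (2 * x)\<^sup>2 / 8"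
      using that by (intro Hoeffdings_lemma_aux) auto
    then have "exp (ln (1 + 1 / 2 * (exp (2 * x) - 1))) \<le> exp (x\<^sup>2 / 2 + x)"
      by (intro iffD2[OF exp_le_cancel_iff]) (simp add: power2_eq_square)
    moreover have "0 < 1 + 1 / 2 * (exp (2 * x) - 1)"
      using exp_gt_zero[of "2 * x"] by (simp add: field_simps del: exp_gt_zero) 
    ultimately have "1 + 1 / 2 * (exp (2 * x) - 1) \<le> exp (x\<^sup>2 / 2) * exp x"
      by (simp only: exp_ln exp_add)
    then have "(1 + 1 / 2 * (exp (2 * x) - 1)) * exp (- x) \<le> exp (x\<^sup>2 / 2) * exp x * exp (- x)"
      by (intro mult_right_mono) auto
    moreover have "exp (2 * x) * exp (- x) = exp x" by (simp flip: exp_add)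
    then have "(1 + 1 / 2 * (exp (2 * x) - 1)) * exp (- x) = (exp x + exp (- x)) / 2"
      by (simp add: algebra_simps add_divide_distrib)
    moreover have "exp (x\<^sup>2 / 2) * exp x * exp (- x) = exp (x\<^sup>2 / 2)"
      by (simp flip: exp_add)
    ultimately show ?thesis by (simp only:)
  qed
  show ?thesis
  proof (cases "0 \<le> x")
    case False
    then show ?thesis using *[of "- x"] by (simp add: add.commute)
  qed (rule *)
qed

context compactor_params
begin

text \<open>The step facts of \<open>insert_cases\<close> summed over the whole input. The last
  conjunct telescopes: arriving items \<le> y fill the potential, and every unit of error takes k
  out of it.\<close>

lemma feed_facts:
  fixes xs :: "'a::linorder list"
  assumes "C * k + size b + length xs \<le> n" "size b \<le> 2 * k * m" "C < 2 ^ m"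
    and "((C', b'), out) \<in> set_pmf (compactor_feed k n xs (C, b))"
  shows "size b' + 2 * length out = size b + length xs \<and> size b' \<le> 2 * k * m \<and> C' < 2 ^ m \<and>
    (size b + length xs \<le> 2 * k * m \<longrightarrow> out = []) \<and>
    (low y b + item_rank xs y \<le> k * m \<longrightarrow>
      item_rank out y = 0 \<and> low y b' = low y b + item_rank xs y) \<and>
    int k * \<bar>2 * int (item_rank out y) + int (low y b') - int (item_rank xs y) - int (low y b)\<bar>
      + pot C' (low y b') \<le> pot C (low y b) + int (item_rank xs y)"
  using assms
proof (induction xs arbitrary: C b C' b' out)
  case (Cons x xs)
  have inv: "C * k + size b + 1 \<le> n" using Cons.prems(1) by simp
  obtain C1 b1 o1 o2 where ins:
    "compactor_insert k n x (C, b) = do {coin \<leftarrow> bernoulli_pmf (1/2);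
       return_pmf ((C1, b1), if coin then o1 else o2)}"
    "C1 * k + size b1 \<le> C * k + size b + 1"
    "size b1 \<le> 2 * k * m"
    "C < 2 ^ m \<Longrightarrow> C1 < 2 ^ m"
    "\<And>out. out \<in> {o1, o2} \<Longrightarrow> size b1 + 2 * length out = size b + 1"
    "size b < 2 * k * m \<Longrightarrow> o1 = [] \<and> o2 = []"
    "\<And>y. \<exists>d\<in>{0, 1}.
       2 * int (item_rank o1 y) + int (low y b1) = of_bool (x \<le> y) + int (low y b) + d \<and>
       2 * int (item_rank o2 y) + int (low y b1) = of_bool (x \<le> y) + int (low y b) - d \<and>
       int k * d + pot C1 (low y b1) \<le> pot C (low y b) + of_bool (x \<le> y)"
    "\<And>y. low y b \<le> k * m \<Longrightarrow> item_rank o1 y = 0 \<and> item_rank o2 y = 0"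
    using insert_cases[OF inv Cons.prems(2), where x = x] by metis
  have "\<exists>o3 \<in> {o1, o2}. \<exists>o4. out = o3 @ o4 \<and> ((C', b'), o4) \<in> set_pmf (compactor_feed k n xs (C1, b1))"
    using Cons.prems(4) by (auto simp: ins(1) bind_assoc_pmf bind_return_pmf split: if_splits)
  then obtain o3 o4 where o: "o3 \<in> {o1, o2}" "out = o3 @ o4"
    "((C', b'), o4) \<in> set_pmf (compactor_feed k n xs (C1, b1))" by blast
  have inv1: "C1 * k + size b1 + length xs \<le> n" using ins(2) Cons.prems(1) by simp
  note IH = Cons.IH[OF inv1 ins(3) ins(4)[OF Cons.prems(3)] o(3)]
  obtain e where e: "\<bar>e\<bar> \<le> 1"
    "2 * int (item_rank o3 y) + int (low y b1) = of_bool (x \<le> y) + int (low y b) + e"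
    "int k * \<bar>e\<bar> + pot C1 (low y b1) \<le> pot C (low y b) + of_bool (x \<le> y)"
  proof -
    obtain d where d: "d\<in>{0, 1}"
       "2 * int (item_rank o1 y) + int (low y b1) = of_bool (x \<le> y) + int (low y b) + d"
       "2 * int (item_rank o2 y) + int (low y b1) = of_bool (x \<le> y) + int (low y b) - d"
       "int k * d + pot C1 (low y b1) \<le> pot C (low y b) + of_bool (x \<le> y)"
      using ins(7) by metis
    then show ?thesis using o(1) that[of d] that[of "- d"] by (auto simp del: of_bool_eq_iff)
  qed
  have size: "size b1 + 2 * length o3 = size b + 1" using ins(5) o(1) by blast
  show ?case
  proof (intro conjI impI)
    show "size b' + 2 * length out = size b + length (x # xs)"
      using IH size o(2) by simp
    show "size b' \<le> 2 * k * m" "C' < 2 ^ m" using IH by auto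
    show "out = []" if "size b + length (x # xs) \<le> 2 * k * m"
    proof -
      have "o3 = []" using that ins(6) o(1) by auto
      then show ?thesis using size IH that o(2) by simp
    qed
    show "item_rank out y = 0" "low y b' = low y b + item_rank (x # xs) y"
      if "low y b + item_rank (x # xs) y \<le> k * m"
    proof -
      have l: "item_rank o1 y = 0" "item_rank o2 y = 0" using that ins(8)[of y] by auto
      then have "item_rank o3 y = 0" using o(1) by auto
      moreover have "int (low y b1) = of_bool (x \<le> y) + int (low y b)"
        using l ins(7)[of y] by auto
      then have "low y b1 = of_bool (x \<le> y) + low y b" by (cases "x \<le> y") auto
      ultimately show "item_rank out y = 0" "low y b' = low y b + item_rank (x # xs) y"
        using IH that o(2) by (simp_all add: add_ac)
    qed
    let ?E = "2 * int (item_rank o4 y) + int (low y b') - int (item_rank xs y) - int (low y b1)"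
    have E: "2 * int (item_rank out y) + int (low y b') - int (item_rank (x # xs) y) - int (low y b) = e + ?E"
      using e(2) o(2) by simp
    have tri: "int k * \<bar>e + ?E\<bar> \<le> int k * \<bar>e\<bar> + int k * \<bar>?E\<bar>"
      unfolding distrib_left[symmetric] by (intro mult_left_mono abs_triangle_ineq) simp
    have r: "int (item_rank (x # xs) y) = of_bool (x \<le> y) + int (item_rank xs y)" by simp
    have "int k * \<bar>?E\<bar> + pot C' (low y b') \<le> pot C1 (low y b1) + int (item_rank xs y)" using IH by blast
    then show "int k * \<bar>2 * int (item_rank out y) + int (low y b') - int (item_rank (x # xs) y) - int (low y b)\<bar>
      + pot C' (low y b') \<le> pot C (low y b) + int (item_rank (x # xs) y)"
      using tri e(3) unfolding E unfolding r by linarith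
  qed
qed auto

lemma feed_mgf:
  fixes xs :: "'a::linorder list" and \<theta> :: real
  assumes "C * k + size b + length xs \<le> n" "size b \<le> 2 * k * m" "C < 2 ^ m"
  shows "(\<integral>\<^sup>+z. ennreal (exp (\<theta> * (2 * real (item_rank (snd z) y) + real (low y (snd (fst z)))))) \<partial>compactor_feed k n xs (C, b))
    \<le> ennreal (exp (\<theta> * (real (item_rank xs y) + real (low y b)) + \<theta>\<^sup>2 / (2 * real k) * (real (item_rank xs y) + real_of_int (pot C (low y b)))))"
  using assms
proof (induction xs arbitrary: C b)
  case Nil
  have "0 \<le> real_of_int (pot C (low y b))" using pot_nonneg[OF Nil(3)] by simp
  then show ?case by simp
next
  case (Cons x xs)
  define g where "g = (\<lambda>z :: 'a compactor \<times> 'a list.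
    exp (\<theta> * (2 * real (item_rank (snd z) y) + real (low y (snd (fst z))))))"
  have inv: "C * k + size b + 1 \<le> n" using Cons.prems(1) by simp
  obtain C1 b1 o1 o2 where ins:
    "compactor_insert k n x (C, b) = do {coin \<leftarrow> bernoulli_pmf (1/2);
       return_pmf ((C1, b1), if coin then o1 else o2)}"
    "C1 * k + size b1 \<le> C * k + size b + 1"
    "size b1 \<le> 2 * k * m"
    "C < 2 ^ m \<Longrightarrow> C1 < 2 ^ m"
    "\<And>y. \<exists>d\<in>{0, 1}.
       2 * int (item_rank o1 y) + int (low y b1) = of_bool (x \<le> y) + int (low y b) + d \<and>
       2 * int (item_rank o2 y) + int (low y b1) = of_bool (x \<le> y) + int (low y b) - d \<and>
       int k * d + pot C1 (low y b1) \<le> pot C (low y b) + of_bool (x \<le> y)"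
    using insert_cases[OF inv Cons.prems(2), where x = x] by metis
  obtain d :: int where d: "d \<in> {0, 1}"
    "2 * int (item_rank o1 y) + int (low y b1) = of_bool (x \<le> y) + int (low y b) + d"
    "2 * int (item_rank o2 y) + int (low y b1) = of_bool (x \<le> y) + int (low y b) - d"
    "int k * d + pot C1 (low y b1) \<le> pot C (low y b) + of_bool (x \<le> y)"
    using ins(5) by metis
  have inv1: "C1 * k + size b1 + length xs \<le> n" using ins(2) Cons.prems(1) by simp
  define \<beta> where "\<beta> = \<theta>\<^sup>2 / (2 * real k)"
  have \<beta>: "0 \<le> \<beta>" by (simp add: \<beta>_def)
  have IH: "(\<integral>\<^sup>+z. ennreal (g z) \<partial>compactor_feed k n xs (C1, b1))
      \<le> ennreal (exp (\<theta> * (real (item_rank xs y) + real (low y b1)) + \<beta> * (real (item_rank xs y) + real_of_int (pot C1 (low y b1)))))"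
    using Cons.IH[OF inv1 ins(3) ins(4)[OF Cons.prems(3)]] unfolding g_def \<beta>_def .
  define A where "A = \<theta> * (real (item_rank (x # xs) y) + real (low y b)) + \<beta> * (real (item_rank xs y) + real_of_int (pot C1 (low y b1)))"
  have branch: "(\<integral>\<^sup>+z. ennreal (g (fst z, o3 @ snd z)) \<partial>compactor_feed k n xs (C1, b1)) \<le> ennreal (exp (A + \<theta> * real_of_int e))"
    if "2 * int (item_rank o3 y) + int (low y b1) = of_bool (x \<le> y) + int (low y b) + e" for o3 e
  proof -
    have "(\<integral>\<^sup>+z. ennreal (g (fst z, o3 @ snd z)) \<partial>compactor_feed k n xs (C1, b1)) =
      (\<integral>\<^sup>+z. ennreal (exp (\<theta> * (2 * real (item_rank o3 y)))) * ennreal (g z) \<partial>compactor_feed k n xs (C1, b1))"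
      by (intro nn_integral_cong) (simp add: g_def algebra_simps flip: ennreal_mult exp_add)
    also have "\<dots> = ennreal (exp (\<theta> * (2 * real (item_rank o3 y)))) * (\<integral>\<^sup>+z. ennreal (g z) \<partial>compactor_feed k n xs (C1, b1))"
      by (intro nn_integral_cmult) auto
    also have "\<dots> \<le> ennreal (exp (\<theta> * (2 * real (item_rank o3 y)))) *
       ennreal (exp (\<theta> * (real (item_rank xs y) + real (low y b1)) + \<beta> * (real (item_rank xs y) + real_of_int (pot C1 (low y b1)))))"
      by (intro mult_left_mono IH) simp
    also have "\<dots> = ennreal (exp (\<theta> * (2 * real (item_rank o3 y) + real (low y b1) + real (item_rank xs y)) + \<beta> * (real (item_rank xs y) + real_of_int (pot C1 (low y b1)))))"
      by (simp add: algebra_simps flip: ennreal_mult exp_add)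
    also have "2 * real (item_rank o3 y) + real (low y b1) = of_bool (x \<le> y) + real (low y b) + real_of_int e"
      using arg_cong[OF that, of real_of_int] by simp
    also have "\<theta> * (of_bool (x \<le> y) + real (low y b) + real_of_int e + real (item_rank xs y)) + \<beta> * (real (item_rank xs y) + real_of_int (pot C1 (low y b1))) = A + \<theta> * real_of_int e"
      by (simp add: A_def algebra_simps)
    finally show ?thesis .
  qed
  have "(\<integral>\<^sup>+z. ennreal (g z) \<partial>compactor_feed k n (x # xs) (C, b)) =
    (\<integral>\<^sup>+z. ennreal (g (fst z, o1 @ snd z)) \<partial>compactor_feed k n xs (C1, b1)) * ennreal (1/2) +
    (\<integral>\<^sup>+z. ennreal (g (fst z, o2 @ snd z)) \<partial>compactor_feed k n xs (C1, b1)) * ennreal (1/2)"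
    by (simp add: ins(1) bind_assoc_pmf bind_return_pmf case_prod_beta' del: ennreal_half)
  also have "\<dots> \<le> ennreal (exp (A + \<theta> * real_of_int d)) * ennreal (1/2) + ennreal (exp (A + \<theta> * - real_of_int d)) * ennreal (1/2)"
    using branch[of o1 d] branch[of o2 "- d"] d(2,3)
    by (intro add_mono mult_right_mono) auto
  also have "\<dots> = ennreal (exp (A + \<theta> * real_of_int d) * (1/2)) + ennreal (exp (A + \<theta> * - real_of_int d) * (1/2))"
    by (simp only: ennreal_mult''[of "1/2", OF divide_nonneg_nonneg[OF zero_le_one zero_le_numeral]])
  also have "\<dots> = ennreal (exp (A + \<theta> * real_of_int d) * (1/2) + exp (A + \<theta> * - real_of_int d) * (1/2))"
    by (intro ennreal_plus[symmetric]) auto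
  also have "exp (A + \<theta> * real_of_int d) * (1/2) + exp (A + \<theta> * - real_of_int d) * (1/2) = exp A * ((exp (\<theta> * real_of_int d) + exp (- (\<theta> * real_of_int d))) / 2)"
    by (simp add: exp_add exp_diff exp_minus field_simps)
  also have "\<dots> \<le> exp A * exp ((\<theta> * real_of_int d)\<^sup>2 / 2)"
    by (intro mult_left_mono cosh_le_exp_square) simp
  also have "\<dots> = exp (A + \<beta> * (real k * real_of_int d))"
    using d(1) k_pos by (auto simp: exp_add \<beta>_def)
  also have "\<dots> \<le> exp (\<theta> * (real (item_rank (x # xs) y) + real (low y b)) + \<beta> * (real (item_rank (x # xs) y) + real_of_int (pot C (low y b))))"
  proof -
    have "real_of_int (int k * d + pot C1 (low y b1)) \<le> real_of_int (pot C (low y b) + of_bool (x \<le> y))"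
      using d(4) by linarith
    then have "\<beta> * (real k * real_of_int d + real_of_int (pot C1 (low y b1))) \<le> \<beta> * (real_of_int (pot C (low y b)) + of_bool (x \<le> y))"
      using \<beta> by (intro mult_left_mono) auto
    then show ?thesis by (simp add: A_def algebra_simps)
  qed
  finally show ?case unfolding g_def \<beta>_def by (simp add: ennreal_leI)
qed

end

section \<open>The error of the whole sketch\<close>

lemma compact_set:
  assumes "((C', b'), out) \<in> set_pmf (compact k (C, b))"
  shows "set_mset b' \<union> set out \<subseteq> set_mset b"
  using assms unfolding compact_def Let_def
  by (auto dest!: in_set_takeD in_set_nthsD in_set_dropD)

lemma compactor_insert_set:
  assumes "(c', out) \<in> set_pmf (compactor_insert k n x c)"
  shows "set_mset (snd c') \<union> set out \<subseteq> insert x (set_mset (snd c))"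
  using assms by (cases c) (fastforce simp: compactor_insert_simps dest: compact_set split: if_splits)

lemma compactor_feed_set:
  "(c', out) \<in> set_pmf (compactor_feed k n xs c) \<Longrightarrow>
     set_mset (snd c') \<union> set out \<subseteq> set xs \<union> set_mset (snd c)"
proof (induction xs arbitrary: c c' out)
  case (Cons x xs)
  then obtain c1 o1 o2 where
    1: "(c1, o1) \<in> set_pmf (compactor_insert k n x c)" and
    2: "(c', o2) \<in> set_pmf (compactor_feed k n xs c1)" and out: "out = o1 @ o2"
    by (fastforce split: prod.splits)
  show ?case using Cons.IH[OF 2] compactor_insert_set[OF 1] out by auto
qed simp

lemma compactor_feed_append:
  "compactor_feed k n (xs @ ys) c = do {
     (c1, o1) \<leftarrow> compactor_feed k n xs c;
     (c2, o2) \<leftarrow> compactor_feed k n ys c1;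
     return_pmf (c2, o1 @ o2)}"
  by (induction xs arbitrary: c)
    (simp_all add: bind_return_pmf bind_return_pmf' bind_assoc_pmf case_prod_beta')

lemma sketch_feed_Nil [simp]: "sketch_feed k n [] cs = return_pmf cs"
  by (simp add: sketch_feed.simps)

text \<open>Level 0 never sees what happens above it. So its work on ys can be exchanged with the
  work of the higher levels on the output of xs; the coins are independent, and this is
  \<open>bind_commute_pmf\<close>.\<close>

lemma sketch_feed_append:
  "sketch_feed k n (xs @ ys) cs = sketch_feed k n xs cs \<bind> sketch_feed k n ys"
proof (induction k n xs cs arbitrary: ys rule: sketch_feed.induct)
  case (1 k n xs cs)
  show ?case
  proof (cases "xs = [] \<or> ys = []")
    case True
    then show ?thesis by (auto simp: bind_return_pmf bind_return_pmf')
  next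
    case False
    let ?c = "case cs of [] \<Rightarrow> empty_compactor | c # _ \<Rightarrow> c"
    have "sketch_feed k n (xs @ ys) cs = do {
        z1 \<leftarrow> compactor_feed k n xs ?c;
        z2 \<leftarrow> compactor_feed k n ys (fst z1);
        cs' \<leftarrow> sketch_feed k n (snd z1 @ snd z2) (tl cs);
        return_pmf (fst z2 # cs')}"
      using False by (subst sketch_feed.simps)
        (simp add: compactor_feed_append bind_assoc_pmf bind_return_pmf case_prod_beta')
    also have "\<dots> = do {
        z1 \<leftarrow> compactor_feed k n xs ?c;
        z2 \<leftarrow> compactor_feed k n ys (fst z1);
        cs1 \<leftarrow> sketch_feed k n (snd z1) (tl cs);
        cs' \<leftarrow> sketch_feed k n (snd z2) cs1;
        return_pmf (fst z2 # cs')}"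
    proof -
      have IH: "sketch_feed k n (snd z1 @ snd z2) (tl cs) =
          sketch_feed k n (snd z1) (tl cs) \<bind> sketch_feed k n (snd z2)"
        if "z1 \<in> set_pmf (compactor_feed k n xs ?c)" for z1 z2
        using 1[of z1 "fst z1" "snd z1" "snd z2"] that False by auto
      show ?thesis
        by (rule bind_pmf_cong[OF refl], rule bind_pmf_cong[OF refl]) (simp add: IH bind_assoc_pmf)
    qed
    also have "\<dots> = do {
        z1 \<leftarrow> compactor_feed k n xs ?c;
        cs1 \<leftarrow> sketch_feed k n (snd z1) (tl cs);
        z2 \<leftarrow> compactor_feed k n ys (fst z1);
        cs' \<leftarrow> sketch_feed k n (snd z2) cs1;
        return_pmf (fst z2 # cs')}"
      by (subst bind_commute_pmf) simp
    also have "\<dots> = do {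
        z1 \<leftarrow> compactor_feed k n xs ?c;
        cs1 \<leftarrow> sketch_feed k n (snd z1) (tl cs);
        sketch_feed k n ys (fst z1 # cs1)}"
    proof -
      have "sketch_feed k n ys (c # cs1) = do {
          z2 \<leftarrow> compactor_feed k n ys c;
          cs' \<leftarrow> sketch_feed k n (snd z2) cs1;
          return_pmf (fst z2 # cs')}" for c cs1
        using False by (subst sketch_feed.simps) (simp add: case_prod_beta')
      then show ?thesis by simp
    qed
    also have "\<dots> = sketch_feed k n xs cs \<bind> sketch_feed k n ys"
    proof -
      have "sketch_feed k n xs cs = do {
          z1 \<leftarrow> compactor_feed k n xs ?c;
          cs1 \<leftarrow> sketch_feed k n (snd z1) (tl cs);
          return_pmf (fst z1 # cs1)}"
        using False by (subst sketch_feed.simps) (simp add: case_prod_beta')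
      then show ?thesis by (simp add: bind_assoc_pmf bind_return_pmf)
    qed
    finally show ?thesis .
  qed
qed

text \<open>Each level may be run to completion before the next one starts, so the whole input of a
  level is fixed before any of its coins is tossed.\<close>

lemma process_stream_eq_sketch_feed: "process_stream k n xs cs = sketch_feed k n xs cs"
proof (induction xs arbitrary: cs)
  case (Cons x xs)
  have "sketch_feed k n (x # xs) cs = sketch_feed k n [x] cs \<bind> sketch_feed k n xs"
    using sketch_feed_append[of k n "[x]" xs cs] by simp
  moreover have "process_stream k n xs = sketch_feed k n xs" by (rule ext) (rule Cons.IH)
  ultimately show ?case by simp
qed simp

lemma sketch_feed_fresh:
  "xs \<noteq> [] \<Longrightarrow> sketch_feed k n xs [] = do {
     z \<leftarrow> compactor_feed k n xs empty_compactor;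
     cs \<leftarrow> sketch_feed k n (snd z) [];
     return_pmf (fst z # cs)}"
  by (subst sketch_feed.simps) (simp add: case_prod_beta')

text \<open>Starting without any level is what the upper levels do as well, which makes the sketch
  self-similar. Only for the empty stream does the initial level 0 make a difference.\<close>

lemma req_sketch_eq:
  "req_sketch k n xs = (if xs = [] then return_pmf [empty_compactor] else sketch_feed k n xs [])"
proof (cases "xs = []")
  case False
  then have "sketch_feed k n xs [empty_compactor] = sketch_feed k n xs []"
    by (simp add: sketch_feed.simps[of k n xs])
  with False show ?thesis by (simp add: req_sketch_def process_stream_eq_sketch_feed)
qed (simp add: req_sketch_def)

section \<open>The distribution of the error, by recursion over the levels\<close>

lemma estimate_simps [simp]:
  "estimate [] y = 0"
  "estimate (c # cs) y = low y (snd c) + 2 * estimate cs y"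
  by (simp_all add: estimate_def sum.lessThan_Suc_shift sum_distrib_left mult.assoc
      del: sum.lessThan_Suc)

text \<open>The error of one level in units of its own weight, given the items \<open>xs\<close> that it receives.\<close>

definition level_err :: "'a::linorder list \<Rightarrow> 'a \<Rightarrow> 'a compactor \<times> 'a list \<Rightarrow> real" where
  "level_err xs y z = 2 * real (item_rank (snd z) y) + real (low y (snd (fst z))) - real (item_rank xs y)"

text \<open>A distribution indexed by the stream alone: the levels above level 0 form a fresh sketch
  of the output of level 0, so \<open>errs\<close> satisfies a recursion without reference to
  sketches.\<close>

definition errs :: "nat \<Rightarrow> nat \<Rightarrow> 'a::linorder \<Rightarrow> 'a list \<Rightarrow> real pmf" where
  "errs k n y xs = map_pmf (Err xs y) (req_sketch k n xs)"

lemma Err_empty [simp]: "Err [] y [] = 0" "Err [] y [empty_compactor] = 0"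
  by (simp_all add: Err_def empty_compactor_def)

lemma errs_Nil [simp]: "errs k n y [] = return_pmf 0"
  by (simp add: errs_def req_sketch_eq)

lemma map_Err_sketch_feed: "map_pmf (Err xs y) (sketch_feed k n xs []) = errs k n y xs"
  by (cases "xs = []") (simp_all add: errs_def req_sketch_eq)

lemma errs_unfold:
  "errs k n y xs = do {
     z \<leftarrow> compactor_feed k n xs empty_compactor;
     map_pmf (\<lambda>v. level_err xs y z + 2 * v) (errs k n y (snd z))}"
proof (cases "xs = []")
  case True
  then show ?thesis by (simp add: bind_return_pmf level_err_def empty_compactor_def)
next
  case False
  have Err: "Err xs y (fst z # cs) = level_err xs y z + 2 * Err (snd z) y cs" for z cs
    by (simp add: Err_def level_err_def)
  show ?thesis
    unfolding map_Err_sketch_feed[symmetric] sketch_feed_fresh[OF False]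
    by (simp add: map_bind_pmf Err map_pmf_def bind_assoc_pmf bind_return_pmf)
qed

text \<open>No buffer or output ever contains an item that was not fed in. The parameters are
  arbitrary, so this also covers k = 0.\<close>

lemma errs_rank_zero:
  assumes "item_rank xs y = 0" "v \<in> set_pmf (errs k n y xs)"
  shows "v = 0"
  using assms
proof (induction "length xs" arbitrary: xs v rule: less_induct)
  case less
  show ?case
  proof (cases "xs = []")
    case False
    obtain c out w where z: "(c, out) \<in> set_pmf (compactor_feed k n xs empty_compactor)"
      "w \<in> set_pmf (errs k n y out)" "v = level_err xs y (c, out) + 2 * w"
      using less.prems(2) by (subst (asm) errs_unfold) auto
    have *: "x \<le> y \<Longrightarrow> x \<notin> set xs" for x
      using less.prems(1) by (auto simp: item_rank_def filter_empty_conv)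
    have sub: "set_mset (snd c) \<union> set out \<subseteq> set xs"
      using compactor_feed_set[OF z(1)] by (simp add: empty_compactor_def)
    have "set_mset (filter_mset (\<lambda>x. x \<le> y) (snd c)) = {}" using sub * by auto
    then have 0: "item_rank out y = 0" "low y (snd c) = 0"
      using sub * by (auto simp: item_rank_def filter_empty_conv)
    have "length out < length xs"
      using compactor_feed_size[OF z(1)] False by (auto simp: empty_compactor_def nonempty_has_size)
    then have "w = 0" using less.hyps[OF _ 0(1) z(2)] by simp
    then show ?thesis using z(3) 0 less.prems(1) by (simp add: level_err_def)
  qed (use less.prems in simp)
qed

context compactor_params
begin

lemma feed_empty:
  fixes xs :: "'a::linorder list"
  assumes "length xs \<le> n" "(c, out) \<in> set_pmf (compactor_feed k n xs empty_compactor)"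
  shows "size (snd c) + 2 * length out = length xs" "size (snd c) \<le> 2 * k * m"
    "length xs \<le> 2 * k * m \<Longrightarrow> out = []"
    "item_rank xs y \<le> k * m \<Longrightarrow> item_rank out y = 0"
    "item_rank xs y \<le> k * m \<Longrightarrow> low y (snd c) = item_rank xs y"
    "real k * \<bar>level_err xs y (c, out)\<bar> \<le> real (item_rank xs y)"
proof -
  obtain C b where c: "c = (C, b)" by (cases c)
  have *: "size b + 2 * length out = length xs \<and> size b \<le> 2 * k * m \<and> C < 2 ^ m \<and>
    (length xs \<le> 2 * k * m \<longrightarrow> out = []) \<and>
    (item_rank xs y \<le> k * m \<longrightarrow> item_rank out y = 0 \<and> low y b = item_rank xs y) \<and>
    int k * \<bar>2 * int (item_rank out y) + int (low y b) - int (item_rank xs y)\<bar>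
      + pot C (low y b) \<le> int (item_rank xs y)"
    using feed_facts[of 0 "{#}" xs C b out y] assms c by (simp add: empty_compactor_def)
  then show "size (snd c) + 2 * length out = length xs" "size (snd c) \<le> 2 * k * m"
    "length xs \<le> 2 * k * m \<Longrightarrow> out = []"
    "item_rank xs y \<le> k * m \<Longrightarrow> item_rank out y = 0"
    "item_rank xs y \<le> k * m \<Longrightarrow> low y (snd c) = item_rank xs y"
    by (auto simp: c)
  have "int k * \<bar>2 * int (item_rank out y) + int (low y b) - int (item_rank xs y)\<bar> \<le> int (item_rank xs y)"
    using * pot_nonneg[of C "low y b"] by linarith
  then have "real_of_int (int k * \<bar>2 * int (item_rank out y) + int (low y b) - int (item_rank xs y)\<bar>)
    \<le> real_of_int (int (item_rank xs y))"
    by (simp only: of_int_le_iff)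
  then show "real k * \<bar>level_err xs y (c, out)\<bar> \<le> real (item_rank xs y)"
    by (simp add: level_err_def c)
qed

lemma errs_small_rank:
  fixes xs :: "'a::linorder list"
  assumes "length xs \<le> n" "item_rank xs y \<le> k * m" "v \<in> set_pmf (errs k n y xs)"
  shows "v = 0"
proof -
  obtain c out w where z: "(c, out) \<in> set_pmf (compactor_feed k n xs empty_compactor)"
      "w \<in> set_pmf (errs k n y out)" "v = level_err xs y (c, out) + 2 * w"
    using assms(3) by (subst (asm) errs_unfold) auto
  have "w = 0" using errs_rank_zero feed_empty(4)[OF assms(1) z(1) assms(2)] z(2) by blast
  then show ?thesis using feed_empty(4,5)[OF assms(1) z(1) assms(2)] z(3)
    by (simp add: level_err_def)
qed

text \<open>A level errs by at most a fraction 1 / k of its rank, so twice the rank of its output is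
  at most 1 + 1 / k times the rank of its input. After J levels the rank is at most k m, and the
  smallest k m items are never compacted.\<close>

lemma errs_deterministic:
  fixes xs :: "'a::linorder list"
  assumes "length xs \<le> n" "real (item_rank xs y) \<le> real (k * m) * 2 ^ J / (1 + 1 / k) ^ J"
    and "v \<in> set_pmf (errs k n y xs)"
  shows "\<bar>v\<bar> \<le> real (item_rank xs y) * ((1 + 1 / k) ^ J - 1)"
  using assms
proof (induction J arbitrary: xs v)
  case 0
  then have "item_rank xs y \<le> k * m" by (simp flip: of_nat_mult)
  then show ?case using errs_small_rank 0 by simp
next
  case (Suc J)
  obtain c out w where z: "(c, out) \<in> set_pmf (compactor_feed k n xs empty_compactor)"
      "w \<in> set_pmf (errs k n y out)" "v = level_err xs y (c, out) + 2 * w"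
    using Suc.prems(3) by (subst (asm) errs_unfold) auto
  let ?r = "real (item_rank xs y)" and ?q = "1 + 1 / real k"
  have q: "0 < ?q" using k_pos by (simp add: add_pos_pos)
  have E: "\<bar>level_err xs y (c, out)\<bar> \<le> ?r / k"
    using feed_empty(6)[OF Suc.prems(1) z(1), of y] k_pos by (simp add: field_simps)
  have "2 * real (item_rank out y) \<le> level_err xs y (c, out) + ?r"
    by (simp add: level_err_def)
  then have out: "2 * real (item_rank out y) \<le> ?q * ?r" using E by (simp add: field_simps)
  then have "2 * real (item_rank out y) \<le> ?q * (real (k * m) * 2 ^ Suc J / ?q ^ Suc J)"
    using Suc.prems(2) q by (smt (verit) mult_left_mono)
  moreover have "Q * (X * 2 ^ Suc J / Q ^ Suc J) = 2 * (X * 2 ^ J / Q ^ J)" if "0 < Q" for Q X :: real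
    using that by (simp add: field_simps)
  note this[OF q, of "real (k * m)"]
  ultimately have "real (item_rank out y) \<le> real (k * m) * 2 ^ J / ?q ^ J"
    by linarith
  moreover have "length out \<le> n" using feed_empty(1)[OF Suc.prems(1) z(1)] Suc.prems(1) by simp
  ultimately have w: "\<bar>w\<bar> \<le> real (item_rank out y) * (?q ^ J - 1)"
    using Suc.IH z(2) by blast
  have "\<bar>v\<bar> \<le> ?r / k + 2 * (real (item_rank out y) * (?q ^ J - 1))"
    unfolding z(3) using E w by linarith
  also have "\<dots> \<le> ?r / k + (?q * ?r) * (?q ^ J - 1)"
    using mult_right_mono[OF out, of "?q ^ J - 1"] by simp
  also have "\<dots> = ?r * (?q ^ Suc J - 1)"
    by (simp add: algebra_simps diff_divide_distrib)
  finally show ?case .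
qed

text \<open>A fresh compactor has potential 0, so the budget is just the rank of the input.\<close>

lemma level_mgf:
  fixes xs :: "'a::linorder list"
  assumes "length xs \<le> n"
  shows "(\<integral>\<^sup>+z. ennreal (exp (A + \<theta> * level_err xs y z)) \<partial>compactor_feed k n xs empty_compactor)
    \<le> ennreal (exp (A + \<theta>\<^sup>2 / (2 * real k) * real (item_rank xs y)))"
proof -
  let ?F = "compactor_feed k n xs empty_compactor"
  let ?B = "A - \<theta> * real (item_rank xs y)"
  have "(\<integral>\<^sup>+z. ennreal (exp (A + \<theta> * level_err xs y z)) \<partial>?F) =
    (\<integral>\<^sup>+z. ennreal (exp ?B) * ennreal (exp (\<theta> * (2 * real (item_rank (snd z) y) + real (low y (snd (fst z)))))) \<partial>?F)"
    by (intro nn_integral_cong) (simp add: level_err_def algebra_simps flip: ennreal_mult exp_add)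
  also have "\<dots> = ennreal (exp ?B) * (\<integral>\<^sup>+z. ennreal (exp (\<theta> * (2 * real (item_rank (snd z) y) + real (low y (snd (fst z)))))) \<partial>?F)"
    by (intro nn_integral_cmult) auto
  also have "\<dots> \<le> ennreal (exp ?B) * ennreal (exp (\<theta> * real (item_rank xs y) + \<theta>\<^sup>2 / (2 * real k) * real (item_rank xs y)))"
    using feed_mgf[of 0 "{#}" xs \<theta> y] assms by (intro mult_left_mono) (simp_all add: empty_compactor_def)
  also have "\<dots> = ennreal (exp (A + \<theta>\<^sup>2 / (2 * real k) * real (item_rank xs y)))"
    by (simp flip: ennreal_mult exp_add)
  finally show ?thesis .
qed

text \<open>
  Here \<open>e\<close> is the error accumulated below level \<open>h\<close>, and \<open>J\<close> is the number of levels above level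
  \<open>H\<close> whose error is estimated deterministically.
\<close>

lemma errs_tail:
  fixes xs :: "'a::linorder list" and R e a :: real and \<theta> \<theta>' :: "nat \<Rightarrow> real"
  defines "q \<equiv> 1 + 1 / real k"
  assumes R: "(1 + a) * R \<le> 2 ^ H * (real (k * m) * 2 ^ J / q ^ J)"
    and \<theta>: "\<And>h. h < H \<Longrightarrow> \<theta> (Suc h) + (\<theta> (Suc h))\<^sup>2 * 2 ^ h / (2 * real k) \<le> \<theta> h"
    and \<theta>': "\<And>h. h < H \<Longrightarrow> \<theta>' (Suc h) + (\<theta>' (Suc h))\<^sup>2 * 2 ^ h / (2 * real k) \<le> \<theta>' h"
    and sgn: "0 \<le> \<theta> H" "\<theta>' H \<le> 0"
    and h: "h \<le> H" and len: "length xs \<le> n" and e: "2 ^ h * real (item_rank xs y) \<le> R + e"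
  shows "emeasure (errs k n y xs) {v. (a + (1 + a) * (q ^ J - 1)) * R \<le> \<bar>e + 2 ^ h * v\<bar>}
    \<le> ennreal (exp (\<theta> h * (R + e) - \<theta> H * ((1 + a) * R))) +
      ennreal (exp (\<theta>' h * (R + e) - \<theta>' H * ((1 - a) * R)))"
  using h len e
proof (induction h arbitrary: xs e rule: inc_induct)
  case base
  have q1: "1 \<le> q ^ J" by (intro one_le_power) (simp add: q_def)
  \<comment> \<open>Markov's inequality in pointwise form: if the lower levels have already erred by
    a R, one of the two exponentials is at least 1. Otherwise the rank at level H is small enough
    for the deterministic estimate.\<close>
  consider "a * R \<le> e" | "e \<le> - a * R" | "\<bar>e\<bar> < a * R" by linarith
  then show ?case
  proof cases
    case 1
    then have "0 \<le> \<theta> H * (e - a * R)" using sgn by simp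
    then have "1 \<le> exp (\<theta> H * (R + e) - \<theta> H * ((1 + a) * R))"
      by (simp add: algebra_simps)
    then have "1 \<le> ennreal (exp (\<theta> H * (R + e) - \<theta> H * ((1 + a) * R)))" by simp
    then show ?thesis
      by (meson add_increasing2 measure_pmf.emeasure_le_1 order_trans zero_le)
  next
    case 2
    then have "0 \<le> \<theta>' H * (e + a * R)" using sgn by (intro mult_nonpos_nonpos) auto
    then have "1 \<le> exp (\<theta>' H * (R + e) - \<theta>' H * ((1 - a) * R))"
      by (simp add: algebra_simps)
    then have "1 \<le> ennreal (exp (\<theta>' H * (R + e) - \<theta>' H * ((1 - a) * R)))" by simp
    then show ?thesis
      by (meson add_increasing measure_pmf.emeasure_le_1 order_trans zero_le)
  next
    case 3
    then have r: "2 ^ H * real (item_rank xs y) \<le> (1 + a) * R"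
      using base by (simp add: algebra_simps)
    then have "2 ^ H * real (item_rank xs y) \<le> 2 ^ H * (real (k * m) * 2 ^ J / q ^ J)"
      using R by linarith
    then have r': "real (item_rank xs y) \<le> real (k * m) * 2 ^ J / q ^ J"
      by (rule mult_left_le_imp_le) simp
    have "\<bar>e + 2 ^ H * v\<bar> < (a + (1 + a) * (q ^ J - 1)) * R" if "v \<in> set_pmf (errs k n y xs)" for v
    proof -
      have "\<bar>v\<bar> \<le> real (item_rank xs y) * (q ^ J - 1)"
        using errs_deterministic[OF base(1) r'[unfolded q_def] that] by (simp add: q_def)
      then have "2 ^ H * \<bar>v\<bar> \<le> 2 ^ H * real (item_rank xs y) * (q ^ J - 1)" by simp
      also have "\<dots> \<le> (1 + a) * R * (q ^ J - 1)" using r q1 by (intro mult_right_mono) auto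
      finally have "\<bar>2 ^ H * v\<bar> \<le> (1 + a) * R * (q ^ J - 1)" by (simp add: abs_mult)
      then show ?thesis using 3 by (simp add: algebra_simps)
    qed
    then have "emeasure (errs k n y xs) {v. (a + (1 + a) * (q ^ J - 1)) * R \<le> \<bar>e + 2 ^ H * v\<bar>} = 0"
      unfolding measure_pmf.emeasure_eq_measure by (fastforce simp: measure_pmf_zero_iff disjoint_iff not_le)
    then show ?thesis by simp
  qed
next
  case (step h)
  let ?F = "compactor_feed k n xs empty_compactor"
  let ?b = "(a + (1 + a) * (q ^ J - 1)) * R"
  have lvl: "(\<integral>\<^sup>+z. ennreal (exp (t' * (R + (e + 2 ^ h * level_err xs y z)) - B)) \<partial>?F) \<le> ennreal (exp (t * (R + e) - B))"
    if t: "t' + t'\<^sup>2 * 2 ^ h / (2 * real k) \<le> t" for t t' B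
  proof -
    have "(\<integral>\<^sup>+z. ennreal (exp (t' * (R + (e + 2 ^ h * level_err xs y z)) - B)) \<partial>?F) =
      (\<integral>\<^sup>+z. ennreal (exp ((t' * (R + e) - B) + (t' * 2 ^ h) * level_err xs y z)) \<partial>?F)"
      by (intro nn_integral_cong) (simp add: algebra_simps)
    also have "\<dots> \<le> ennreal (exp ((t' * (R + e) - B) + (t' * 2 ^ h)\<^sup>2 / (2 * real k) * real (item_rank xs y)))"
      by (rule level_mgf[OF step.prems(1)])
    also have "\<dots> \<le> ennreal (exp (t * (R + e) - B))"
    proof (intro ennreal_leI iffD2[OF exp_le_cancel_iff])
      have "0 \<le> R + e" using step.prems(2) by (smt (verit) mult_nonneg_nonneg of_nat_0_le_iff zero_le_power)
      \<comment> \<open>The squared weight 4^h meets a rank of at most (R + e) / 2^h, so one factor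
        2^h remains and the bound is again linear in R + e.\<close>
      have "(t' * 2 ^ h)\<^sup>2 / (2 * real k) * real (item_rank xs y) = t'\<^sup>2 * 2 ^ h / (2 * real k) * (2 ^ h * real (item_rank xs y))"
        by (simp add: power_mult_distrib power2_eq_square)
      also have "\<dots> \<le> t'\<^sup>2 * 2 ^ h / (2 * real k) * (R + e)"
        using step.prems(2) by (intro mult_left_mono) auto
      finally have "t' * (R + e) + (t' * 2 ^ h)\<^sup>2 / (2 * real k) * real (item_rank xs y) \<le> (t' + t'\<^sup>2 * 2 ^ h / (2 * real k)) * (R + e)"
        by (simp add: distrib_right)
      also have "\<dots> \<le> t * (R + e)" using t \<open>0 \<le> R + e\<close> by (intro mult_right_mono)
      finally show "t' * (R + e) - B + (t' * 2 ^ h)\<^sup>2 / (2 * real k) * real (item_rank xs y) \<le> t * (R + e) - B" by simp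
    qed
    finally show ?thesis .
  qed
  have "emeasure (errs k n y xs) {v. ?b \<le> \<bar>e + 2 ^ h * v\<bar>} =
    (\<integral>\<^sup>+z. emeasure (errs k n y (snd z)) {v. ?b \<le> \<bar>(e + 2 ^ h * level_err xs y z) + 2 ^ Suc h * v\<bar>} \<partial>?F)"
    by (subst errs_unfold) (simp add: vimage_def algebra_simps)
  also have "\<dots> \<le> (\<integral>\<^sup>+z. ennreal (exp (\<theta> (Suc h) * (R + (e + 2 ^ h * level_err xs y z)) - \<theta> H * ((1 + a) * R))) +
      ennreal (exp (\<theta>' (Suc h) * (R + (e + 2 ^ h * level_err xs y z)) - \<theta>' H * ((1 - a) * R))) \<partial>?F)"
  proof (intro nn_integral_mono_AE AE_pmfI)
    fix z assume z: "z \<in> set_pmf ?F"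
    obtain c out where zc: "z = (c, out)" by (cases z)
    have "length (snd z) \<le> n"
      using feed_empty(1)[OF step.prems(1), of c out] z zc step.prems(1) by simp
    moreover have "2 * real (item_rank (snd z) y) \<le> level_err xs y z + item_rank xs y"
      by (simp add: level_err_def)
    then have "2 ^ h * (2 * real (item_rank (snd z) y)) \<le> 2 ^ h * (level_err xs y z + item_rank xs y)"
      by (intro mult_left_mono) auto
    then have "2 ^ Suc h * real (item_rank (snd z) y) \<le> R + (e + 2 ^ h * level_err xs y z)"
      using step.prems(2) by (simp add: algebra_simps)
    ultimately show "emeasure (errs k n y (snd z)) {v. ?b \<le> \<bar>(e + 2 ^ h * level_err xs y z) + 2 ^ Suc h * v\<bar>} \<le>
      ennreal (exp (\<theta> (Suc h) * (R + (e + 2 ^ h * level_err xs y z)) - \<theta> H * ((1 + a) * R))) +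
      ennreal (exp (\<theta>' (Suc h) * (R + (e + 2 ^ h * level_err xs y z)) - \<theta>' H * ((1 - a) * R)))"
      by (rule step.IH)
  qed
  also have "\<dots> = (\<integral>\<^sup>+z. ennreal (exp (\<theta> (Suc h) * (R + (e + 2 ^ h * level_err xs y z)) - \<theta> H * ((1 + a) * R))) \<partial>?F) +
      (\<integral>\<^sup>+z. ennreal (exp (\<theta>' (Suc h) * (R + (e + 2 ^ h * level_err xs y z)) - \<theta>' H * ((1 - a) * R))) \<partial>?F)"
    by (intro nn_integral_add) auto
  also have "\<dots> \<le> ennreal (exp (\<theta> h * (R + e) - \<theta> H * ((1 + a) * R))) +
      ennreal (exp (\<theta>' h * (R + e) - \<theta>' H * ((1 - a) * R)))"
    using step.hyps by (intro add_mono lvl \<theta> \<theta>')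
  finally show ?case .
qed

end

section \<open>The tail bound\<close>

text \<open>Covers both error-free regimes: a capacity that is not positive and an input that fits
  into the buffer.\<close>

lemma compactor_feed_no_output:
  assumes "capacity k n \<le> 0 \<or> int (size (snd c) + length xs) \<le> capacity k n"
    and "(c', out) \<in> set_pmf (compactor_feed k n xs c)"
  shows "out = [] \<and> snd c' = mset xs + snd c"
  using assms
proof (induction xs arbitrary: c c' out)
  case (Cons x xs)
  then obtain c1 o1 o2 where
    1: "(c1, o1) \<in> set_pmf (compactor_insert k n x c)" and
    2: "(c', o2) \<in> set_pmf (compactor_feed k n xs c1)" and out: "out = o1 @ o2"
    by (fastforce split: prod.splits)
  obtain C b where c: "c = (C, b)" by (cases c)
  have "snd c1 = add_mset x (snd c) \<and> o1 = []"
  proof (cases "int (size b) = capacity k n")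
    case True
    \<comment> \<open>A compaction can occur here only at capacity 0, on an empty buffer; it
      advances the state and outputs nothing.\<close>
    then have "int (size b) \<le> 0" using Cons.prems(1) unfolding c by auto
    then have b: "b = {#}" by simp
    show ?thesis using 1 True unfolding c b
      by (auto simp: compactor_insert_simps dest!: compact_set)
  next
    case False
    then show ?thesis using 1 by (simp add: c compactor_insert_simps)
  qed
  moreover from this have "capacity k n \<le> 0 \<or> int (size (snd c1) + length xs) \<le> capacity k n"
    using Cons.prems(1) by auto
  ultimately show ?case using Cons.IH[OF _ 2] out by auto
qed auto

lemma errs_no_output:
  assumes "capacity k n \<le> 0 \<or> int (length xs) \<le> capacity k n" "v \<in> set_pmf (errs k n y xs)"
  shows "v = 0"
proof -
  obtain c out w where z: "(c, out) \<in> set_pmf (compactor_feed k n xs empty_compactor)"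
      "w \<in> set_pmf (errs k n y out)" "v = level_err xs y (c, out) + 2 * w"
    using assms(2) by (subst (asm) errs_unfold) auto
  have "out = [] \<and> snd c = mset xs"
    using compactor_feed_no_output[OF _ z(1)] assms(1) by (simp add: empty_compactor_def)
  then show ?thesis using z(2,3) by (simp add: level_err_def low_mset)
qed

lemma capacity_cases:
  assumes "0 < k" "even k"
  obtains "capacity k n \<le> 0" "n \<le> k"
  | m where "compactor_params k n m" "k < n" "real m < log 2 (real n / real k) + 1"
proof (cases "n \<le> k")
  case True
  have "log 2 (real n / real k) \<le> 0"
  \<comment> \<open>For n = 0 the logarithm of 0 is 0 by convention.\<close>
  proof (cases "n = 0")
    case False
    then show ?thesis using True assms by (subst log_le_zero_cancel_iff) auto
  qed (simp add: log_def)
  then have "\<lceil>log 2 (real n / real k)\<rceil> \<le> 0" by simp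
  then have "capacity k n \<le> 0" unfolding capacity_def by (intro mult_nonneg_nonpos) auto
  with True show ?thesis by (rule that(1)[rotated])
next
  case False
  define g where "g = log 2 (real n / real k)"
  define m where "m = nat \<lceil>g\<rceil>"
  have g: "0 < g" using False assms unfolding g_def by (subst zero_less_log_cancel_iff) auto
  then have m: "int m = \<lceil>g\<rceil>" by (simp add: m_def)
  have gm: "g \<le> real m" "real m < g + 1" using m by linarith+
  have "real n / real k = 2 powr g" using False assms by (simp add: g_def)
  also have "\<dots> \<le> 2 powr real m" using gm by (intro powr_mono) auto
  finally have "real n \<le> real (k * 2 ^ m)" using assms by (simp add: powr_realpow field_simps)
  then have "n \<le> k * 2 ^ m" by (simp only: of_nat_le_iff)
  moreover have "0 < m" using g gm(1) by linarith
  moreover have "capacity k n = 2 * int k * int m" by (simp add: capacity_def m g_def)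
  ultimately have "compactor_params k n m"
    using assms by unfold_locales auto
  then show ?thesis using that(2) False gm by (auto simp: g_def)
qed

lemma exists_scale:
  fixes R T :: real
  assumes "0 < T" "0 < R"
  obtains "R \<le> T" | H where "R \<le> 2 ^ H * T" "2 ^ H * T < 2 * R"
proof (cases "R \<le> T")
  case False
  obtain H0 where H0: "R / T < 2 ^ H0" using real_arch_pow[of 2 "R / T"] by auto
  define H where "H = (LEAST H. R \<le> 2 ^ H * T)"
  have ex: "R \<le> 2 ^ H0 * T" using H0 assms by (simp add: field_simps)
  then have H: "R \<le> 2 ^ H * T" unfolding H_def by (rule LeastI)
  then obtain H' where H': "H = Suc H'" using False by (cases H) auto
  then have "\<not> R \<le> 2 ^ H' * T" unfolding H_def using not_less_Least[of H'] by (metis H_def lessI)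
  then show ?thesis using that(2)[OF H] H' by simp
qed

context compactor_params
begin

lemma errs_prob:
  fixes xs :: "'a::linorder list" and \<epsilon> :: real
  assumes len: "length xs \<le> n" and \<epsilon>: "0 < \<epsilon>" "\<epsilon> \<le> 1" and rank: "0 < item_rank xs y"
    and growth: "(1 + 1 / real k) ^ J \<le> 1 + 17 / 256 * \<epsilon>" and m3: "3 \<le> m"
  shows "measure_pmf.prob (errs k n y xs) {v. \<epsilon> * real (item_rank xs y) \<le> \<bar>v\<bar>}
    \<le> 2 * exp (- (178 / 1000 * (\<epsilon> * real k)\<^sup>2 * 2 ^ J))"
proof -
  define R where "R = real (item_rank xs y)"
  define q where "q = (1 + 1 / real k) ^ J"
  \<comment> \<open>Splitting the error budget: 4 / 5 of it for the random levels, the rest for the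
    J deterministic ones, which need at most 9 / 5 * 17 / 256 of it.\<close>
  define a where "a = 4 / 5 * \<epsilon>"
  \<comment> \<open>The deterministic estimate reaches ranks up to T (1 + a); the factor 1 + a
    leaves room for the error made below level H.\<close>
  define T where "T = real (k * m) * 2 ^ J / q / (1 + a)"
  have R: "0 < R" using rank by (simp add: R_def)
  have q: "1 \<le> q" "q \<le> 1 + 17 / 256 * \<epsilon>" unfolding q_def using growth by (auto intro!: one_le_power)
  have a: "0 < a" "a \<le> 4 / 5" using \<epsilon> by (auto simp: a_def)
  have T: "0 < T" using q a k_pos m_pos by (auto simp: T_def intro!: divide_pos_pos mult_pos_pos)
  have "(1 + a) * (q - 1) \<le> 9 / 5 * (17 / 256 * \<epsilon>)"
    using a q by (intro mult_mono) auto
  then have tot: "a + (1 + a) * (q - 1) < \<epsilon>" using \<epsilon> by (simp add: a_def)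
  show ?thesis
  proof (cases rule: exists_scale[OF T R])
    case 1
    have "T \<le> real (k * m) * 2 ^ J / q"
      unfolding T_def using a q divide_left_mono[of 1 "1 + a" "real (k * m) * 2 ^ J / q"] by simp
    then have r: "R \<le> real (k * m) * 2 ^ J / q" using 1 by linarith
    have "\<bar>v\<bar> < \<epsilon> * R" if "v \<in> set_pmf (errs k n y xs)" for v
    proof -
      have "\<bar>v\<bar> \<le> R * (q - 1)"
        unfolding R_def q_def by (rule errs_deterministic[OF len r[unfolded R_def q_def] that])
      also have "\<dots> < R * \<epsilon>" using R q(2) \<epsilon> by (intro mult_strict_left_mono) auto
      finally show ?thesis by (simp add: mult.commute)
    qed
    then have "measure_pmf.prob (errs k n y xs) {v. \<epsilon> * R \<le> \<bar>v\<bar>} = 0"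
      by (fastforce simp: measure_pmf_zero_iff disjoint_iff not_le)
    then show ?thesis by (simp add: R_def)
  next
    case (2 H)
    \<comment> \<open>On the scale K R the upper tail has exponent at most t / (1 - t / 2) - t (1 +
      a). Its minimizer is close to a for small a and about 0.51 at a = 4 / 5; the choice 2 a / 3 is
      near-optimal at that critical end, and both tails reach -9 / 25 a^2 with it.\<close>
    define t where "t = 2 / 3 * a"
    have t: "0 < t" "t \<le> 8 / 15" using a by (auto simp: t_def)
    define K where "K = real k / 2 ^ H"
    have K: "0 < K" using k_pos by (simp add: K_def)
    \<comment> \<open>Explicit solutions of the recursive inequality: \<open>1 / \<theta> h\<close> is linear in \<open>2 ^ h\<close>, and so is \<open>\<theta>' h\<close>.\<close>
    define D where "D h = 1 - t / 2 * (1 - 2 ^ h / 2 ^ H)" for h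
    define P where "P h = t - t\<^sup>2 / 2 * (1 - 2 ^ h / 2 ^ H)" for h
    define \<theta> where "\<theta> h = K * (t / D h)" for h
    define \<theta>' where "\<theta>' h = - (K * P h)" for h
    have D_pos: "0 < D h" if "h \<le> H" for h
    proof -
      have "t / 2 * (1 - 2 ^ h / 2 ^ H) \<le> t / 2 * 1" using t by (intro mult_left_mono) auto
      then show ?thesis using t unfolding D_def by linarith
    qed
    have step: "\<theta> (Suc h) + (\<theta> (Suc h))\<^sup>2 * 2 ^ h / (2 * real k) \<le> \<theta> h" if "h < H" for h
    proof -
      define x :: real where "x = 2 ^ h / 2 ^ H"
      have D': "D (Suc h) = D h + t * x / 2" by (simp add: D_def x_def field_simps)
      have pos: "0 < D h" "0 < D (Suc h)" using D_pos that by auto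
      have "(\<theta> (Suc h))\<^sup>2 * 2 ^ h / (2 * real k) = K * (t * (t * x / 2) / (D (Suc h))\<^sup>2)"
        using k_pos by (simp add: \<theta>_def K_def x_def power2_eq_square field_simps)
      also have "t * x / 2 = D (Suc h) - D h" using D' by simp
      finally have eq: "(\<theta> (Suc h))\<^sup>2 * 2 ^ h / (2 * real k) =
          K * (t * (D (Suc h) - D h) / (D (Suc h))\<^sup>2)" .
      have "\<theta> (Suc h) + (\<theta> (Suc h))\<^sup>2 * 2 ^ h / (2 * real k) =
          K * t * ((2 * D (Suc h) - D h) / (D (Suc h))\<^sup>2)"
        unfolding eq unfolding \<theta>_def using pos by (simp add: field_simps power2_eq_square)
      also have "\<dots> \<le> K * t * (1 / D h)"
      proof (intro mult_left_mono)
        \<comment> \<open>The reciprocal 1 / D is convex and so lies above its tangent at D (Suc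
          h).\<close>
        have "D h * (2 * D (Suc h) - D h) \<le> (D (Suc h))\<^sup>2"
          using zero_le_power2[of "D (Suc h) - D h"] by (simp add: power2_eq_square algebra_simps)
        then show "(2 * D (Suc h) - D h) / (D (Suc h))\<^sup>2 \<le> 1 / D h"
          using pos by (simp add: field_simps)
      qed (use K t in auto)
      finally show ?thesis by (simp add: \<theta>_def)
    qed
    have step': "\<theta>' (Suc h) + (\<theta>' (Suc h))\<^sup>2 * 2 ^ h / (2 * real k) \<le> \<theta>' h" if "h < H" for h
    proof -
      define x :: real where "x = 2 ^ h / 2 ^ H"
      have x: "0 \<le> x" "2 * x \<le> 1"
      proof -
        have "(2::real) ^ Suc h \<le> 2 ^ H" using that by (intro power_increasing) auto
        then show "2 * x \<le> 1" by (simp add: x_def)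
      qed (simp add: x_def)
      have P': "P (Suc h) = P h + t\<^sup>2 * x / 2" by (simp add: P_def x_def field_simps)
      have "t\<^sup>2 / 2 * (1 - 2 * x) \<le> t\<^sup>2 / 2 * 1" using x by (intro mult_left_mono) auto
      also have "\<dots> \<le> t" using t by (simp add: power2_eq_square)
      finally have "0 \<le> P (Suc h)" by (simp add: P_def x_def)
      moreover have "0 \<le> t\<^sup>2 / 2 * (1 - 2 * x)" using x by simp
      then have "P (Suc h) \<le> t" by (simp add: P_def x_def)
      \<comment> \<open>On this side the quadratic term shrinks the modulus of \<theta>', so
        bounding P by its final value t is enough and a linear solution works.\<close>
      ultimately have "(P (Suc h))\<^sup>2 \<le> t\<^sup>2" by (intro power_mono) auto
      then have "(P (Suc h))\<^sup>2 * x / 2 \<le> t\<^sup>2 * x / 2" using x by (simp add: mult_right_mono)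
      then have "K * ((P (Suc h))\<^sup>2 * x / 2) \<le> K * (P (Suc h) - P h)"
        using P' K by (intro mult_left_mono) auto
      moreover have "(\<theta>' (Suc h))\<^sup>2 * 2 ^ h / (2 * real k) = K * ((P (Suc h))\<^sup>2 * x / 2)"
        using k_pos by (simp add: \<theta>'_def K_def x_def power2_eq_square field_simps)
      ultimately show ?thesis by (simp add: \<theta>'_def algebra_simps)
    qed
    have KR: "774 / 1000 * (real k)\<^sup>2 * 2 ^ J \<le> K * R"
    proof -
      \<comment> \<open>By minimality of H, R / 2^H exceeds T / 2, so K R is at least m k^2 2^J / (2
        q (1 + a)); with m \<ge> 3 the numerical factor is (3 / 2) / (273 / 256 * 9 / 5), above 774
        / 1000. Multiplied by 9 / 25 * (4 / 5)^2 it gives 178 / 1000.\<close>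
      have "q * (1 + a) \<le> 273 / 256 * (9 / 5)" using q a \<epsilon> by (intro mult_mono) auto
      then have "774 / 1000 * (q * (1 + a)) \<le> 3 / 2" by linarith
      then have "774 / 1000 \<le> 3 / 2 / (q * (1 + a))"
        using q a by (subst pos_le_divide_eq) (auto intro: mult_pos_pos)
      then have "774 / 1000 * ((real k)\<^sup>2 * 2 ^ J) \<le> 3 / 2 / (q * (1 + a)) * ((real k)\<^sup>2 * 2 ^ J)"
        by (intro mult_right_mono) auto
      also have "\<dots> = 3 * ((real k)\<^sup>2 * 2 ^ J / (q * (1 + a)) / 2)" by simp
      also have "\<dots> \<le> real m * ((real k)\<^sup>2 * 2 ^ J / (q * (1 + a)) / 2)"
        using m3 q a by (intro mult_right_mono) auto
      also have "\<dots> = real k * T / 2" using q a by (simp add: T_def power2_eq_square field_simps)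
      also have "\<dots> \<le> K * R"
        using 2(2) k_pos by (simp add: K_def field_simps)
      finally show ?thesis by (simp add: mult.assoc)
    qed
    define E where "E = 178 / 1000 * (\<epsilon> * real k)\<^sup>2 * 2 ^ J"
    have E: "E \<le> K * R * (9 / 25 * a\<^sup>2)"
    proof -
      have "E \<le> 774 / 1000 * (real k)\<^sup>2 * 2 ^ J * (9 / 25 * a\<^sup>2)"
        unfolding E_def a_def using \<epsilon> by (simp add: power_mult_distrib power2_eq_square)
      also have "\<dots> \<le> K * R * (9 / 25 * a\<^sup>2)" using KR by (intro mult_right_mono) auto
      finally show ?thesis .
    qed
    have ends: "D H = 1" "P H = t" "\<theta> H = K * t" "\<theta>' H = - (K * t)" "0 < D 0"
      using D_pos[of 0] by (simp_all add: D_def P_def \<theta>_def \<theta>'_def)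
    have up: "\<theta> 0 * R - \<theta> H * ((1 + a) * R) \<le> - E"
    proof -
      have "t / 2 * (1 - 2 ^ 0 / 2 ^ H) \<le> t / 2 * 1" using t by (intro mult_left_mono) auto
      then have "1 - t / 2 \<le> D 0" by (simp add: D_def)
      then have "t / D 0 \<le> t / (1 - t / 2)"
        using t ends(5) by (intro divide_left_mono mult_pos_pos) auto
      also have "\<dots> = 2 * a / (3 - a)" using a by (simp add: t_def field_simps)
      also have "\<dots> \<le> t * (1 + a) - 9 / 25 * a\<^sup>2"
      proof -
        have "2 * a \<le> (2 / 3 * a * (1 + a) - 9 / 25 * a\<^sup>2) * (3 - a)"
        proof -
          \<comment> \<open>The last factor stays positive up to a = 19 / 23, only just beyond 4 /
            5; this limits the constant 9 / 25.\<close>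
          have "(2 / 3 * a * (1 + a) - 9 / 25 * a\<^sup>2) * (3 - a) - 2 * a = a\<^sup>2 * (19 / 75 - 23 / 75 * a)"
            by (simp add: power2_eq_square field_simps)
          moreover have "0 \<le> a\<^sup>2 * (19 / 75 - 23 / 75 * a)" using a by (intro mult_nonneg_nonneg) auto
          ultimately show ?thesis by linarith
        qed
        then show ?thesis using a by (simp add: t_def pos_divide_le_eq)
      qed
      finally have "K * R * (t / D 0 - t * (1 + a)) \<le> K * R * - (9 / 25 * a\<^sup>2)"
        using K R by (intro mult_left_mono) auto
      then show ?thesis using E by (simp add: \<theta>_def ends algebra_simps)
    qed
    have low: "\<theta>' 0 * R - \<theta>' H * ((1 - a) * R) \<le> - E"
    proof -
      have "t\<^sup>2 / 2 * (1 - 1 / 2 ^ H) \<le> t\<^sup>2 / 2 * 1" by (intro mult_left_mono) auto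
      then have "t - t\<^sup>2 / 2 \<le> P 0" by (simp add: P_def)
      moreover have "t\<^sup>2 / 2 - t * a \<le> - (9 / 25 * a\<^sup>2)" by (simp add: t_def power2_eq_square)
      ultimately have "K * R * (t * (1 - a) - P 0) \<le> K * R * - (9 / 25 * a\<^sup>2)"
        using K R by (intro mult_left_mono) (auto simp: algebra_simps)
      then show ?thesis using E by (simp add: \<theta>'_def ends algebra_simps)
    qed
    have "(1 + a) * R \<le> (1 + a) * (2 ^ H * T)" using 2(1) a by (intro mult_left_mono) auto
    also have "\<dots> = 2 ^ H * ((1 + a) * T)" by (rule mult.left_commute)
    also have "(1 + a) * T = real (k * m) * 2 ^ J / (1 + 1 / real k) ^ J"
      using a by (simp add: T_def flip: q_def)
    finally have "(1 + a) * R \<le> 2 ^ H * (real (k * m) * 2 ^ J / (1 + 1 / real k) ^ J)" .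
    note tail = errs_tail[OF this step step' _ _ le0 len, where e = 0 and y = y]
    have "emeasure (errs k n y xs) {v. (a + (1 + a) * (q - 1)) * R \<le> \<bar>0 + 2 ^ 0 * v\<bar>}
      \<le> ennreal (exp (\<theta> 0 * (R + 0) - \<theta> H * ((1 + a) * R))) +
        ennreal (exp (\<theta>' 0 * (R + 0) - \<theta>' H * ((1 - a) * R)))"
      unfolding q_def by (rule tail) (use K t in \<open>auto simp: ends R_def\<close>)
    also have "\<dots> \<le> ennreal (exp (- E)) + ennreal (exp (- E))"
      using up low by (intro add_mono ennreal_leI iffD2[OF exp_le_cancel_iff]) auto
    also have "\<dots> = ennreal (2 * exp (- E))" by (simp flip: ennreal_plus)
    finally have "measure_pmf.prob (errs k n y xs) {v. (a + (1 + a) * (q - 1)) * R \<le> \<bar>v\<bar>} \<le> 2 * exp (- E)"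
      by (simp add: measure_pmf.emeasure_eq_measure)
    moreover have "measure_pmf.prob (errs k n y xs) {v. \<epsilon> * R \<le> \<bar>v\<bar>} \<le>
      measure_pmf.prob (errs k n y xs) {v. (a + (1 + a) * (q - 1)) * R \<le> \<bar>v\<bar>}"
    proof (rule measure_pmf.finite_measure_mono)
      have "(a + (1 + a) * (q - 1)) * R \<le> \<epsilon> * R" using tot R by (intro mult_right_mono) auto
      then show "{v. \<epsilon> * R \<le> \<bar>v\<bar>} \<subseteq> {v. (a + (1 + a) * (q - 1)) * R \<le> \<bar>v\<bar>}" by auto
    qed simp
    ultimately show ?thesis by (simp add: R_def E_def)
  qed
qed

end

section \<open>Numerical estimates\<close>

lemma ln_3_ge: "549 / 500 \<le> ln (3::real)"
proof -
  have "(\<Sum>k<4. 2 * ((3 - 1) / (3 + 1)) ^ (2 * k + 1) / real (2 * k + 1)) \<le> ln (3::real)"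
    using ln_approx_bounds[of 3 4] by simp
  then show ?thesis by (simp add: eval_nat_numeral)
qed

text \<open>Makes the slack 2 / 5 in the exponent affordable: 2 exp (2 / 5) < 3.\<close>

lemma exp_two_fifths_less: "exp (2 / 5) < (3 / 2 :: real)"
proof -
  have "(\<Sum>k<2. 2 * ((3 / 2 - 1) / (3 / 2 + 1)) ^ (2 * k + 1) / real (2 * k + 1)) \<le> ln (3 / 2 :: real)"
    using ln_approx_bounds[of "3 / 2" 2] by simp
  then have "2 / 5 < ln (3 / 2 :: real)" by (simp add: eval_nat_numeral)
  then have "exp (2 / 5) < exp (ln (3 / 2 :: real))" by (rule iffD2[OF exp_less_cancel_iff])
  then show ?thesis by simp
qed

text \<open>The fraction is the first term of the artanh series of ln v, and 36 / 25 is a lower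
  bound for 1 / ln 2.\<close>

lemma log2_ge:
  fixes v :: real
  assumes "1 < v"
  shows "36 / 25 * (2 * (v - 1) / (v + 1)) \<le> log 2 v"
proof -
  have 1: "2 * (v - 1) / (v + 1) \<le> ln v"
    using ln_approx_bounds[of v 1] assms by simp
  have "0 < 2 * (v - 1) / (v + 1)" using assms by simp
  then have pos: "0 < ln v" using 1 by linarith
  have "36 / 25 * ln v * ln 2 \<le> 36 / 25 * ln v * (25 / 36)"
    using pos ln2_le_25_over_36 by (intro mult_left_mono) auto
  then have "36 / 25 * ln v \<le> log 2 v" by (simp add: log_def pos_le_divide_eq)
  then show ?thesis using 1 by linarith
qed

text \<open>For v \<ge> 2 the power 2^J is at least v / 2 and there is much to spare. For v < 2 it
  is 1 and the logarithm is small: at v = 549 / 500, just below ln 3, the right side is only about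
  0.83, so the 2 / 5 cannot be omitted.\<close>

lemma exponent_bound:
  fixes v :: real
  assumes v: "549 / 500 \<le> v"
  shows "v - 2 / 5 \<le> 178 / 1000 * (16 * log 2 v)\<^sup>2 * 2 ^ nat \<lfloor>log 2 v\<rfloor>"
proof (cases "v < 2")
  case True
  define x where "x = v - 1"
  have x: "49 / 500 \<le> x" "x \<le> 1" using v True by (auto simp: x_def)
  have u: "36 / 25 * (2 * x / (2 + x)) \<le> log 2 v" using log2_ge[of v] v by (simp add: x_def add.commute)
  have "0 \<le> 36 / 25 * (2 * x / (2 + x))" using x by simp
  then have "(36 / 25 * (2 * x / (2 + x)))\<^sup>2 \<le> (log 2 v)\<^sup>2" using u by (intro power_mono)
  moreover have "v - 2 / 5 \<le> 178 / 1000 * 256 * (36 / 25 * (2 * x / (2 + x)))\<^sup>2"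
  proof -
    \<comment> \<open>The lower bound on x lets x * x dominate all lower powers after multiplication
      by (2 + x)^2.\<close>
    have xx: "49 / 500 * x \<le> x * x" "x * x \<le> x" "x * (x * x) \<le> x * x"
      using x by (auto intro: mult_right_mono mult_left_le)
    have "(x + 3 / 5) * ((2 + x) * (2 + x)) = x * (x * x) + 23 / 5 * (x * x) + 32 / 5 * x + 12 / 5"
      by (simp add: algebra_simps)
    also have "\<dots> \<le> 178 / 1000 * 256 * (72 / 25 * 72 / 25) * (x * x)" using xx x by linarith
    finally have "x + 3 / 5 \<le> 178 / 1000 * 256 * (72 / 25 * 72 / 25) * (x * x) / ((2 + x) * (2 + x))"
      using x by (subst pos_le_divide_eq) auto
    moreover have sq: "(36 / 25 * (2 * x / w))\<^sup>2 = 72 / 25 * (72 / 25) * (x * x) / (w * w)" for w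
      by (simp add: power2_eq_square)
    moreover have v_eq: "v - 2 / 5 = x + 3 / 5" by (simp add: x_def)
    ultimately show ?thesis unfolding sq v_eq by simp
  qed
  moreover have "1 \<le> (2::real) ^ nat \<lfloor>log 2 v\<rfloor>" by simp
  then have "178 / 1000 * (16 * log 2 v)\<^sup>2 * 1 \<le> 178 / 1000 * (16 * log 2 v)\<^sup>2 * 2 ^ nat \<lfloor>log 2 v\<rfloor>"
    by (intro mult_left_mono) auto
  ultimately show ?thesis by (simp add: power_mult_distrib)
next
  case False
  define u where "u = log 2 v"
  have u: "1 \<le> u" using False by (simp add: u_def le_log_iff)
  define J where "J = nat \<lfloor>u\<rfloor>"
  have J: "u \<le> real (J + 1)" using u by (simp add: J_def) linarith
  have "v = 2 powr u" using v by (simp add: u_def)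
  also have "\<dots> \<le> 2 powr real (J + 1)" using J by (intro powr_mono) auto
  also have "\<dots> = 2 * 2 ^ J" by (simp add: powr_realpow powr_add)
  finally have "v \<le> 2 * 2 ^ J" .
  moreover have "2 * 2 ^ J \<le> 178 / 1000 * (16 * u)\<^sup>2 * 2 ^ J"
  proof (intro mult_right_mono)
    have "1 \<le> u\<^sup>2" using u by simp
    then show "2 \<le> 178 / 1000 * (16 * u)\<^sup>2" by (simp add: power_mult_distrib)
  qed simp
  ultimately show ?thesis unfolding u_def[symmetric] J_def[symmetric] by linarith
qed

text \<open>Here J / k \<le> \<epsilon> / 16, and 17 / 256 = 1 / 16 + 1 / 256 comes from the
  quadratic bound on exp (\<epsilon> / 16).\<close>

lemma one_plus_inverse_power_le:
  fixes \<epsilon> u k :: real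
  assumes "0 < \<epsilon>" "\<epsilon> \<le> 1" "0 < u" "16 * u / \<epsilon> \<le> k" "real J \<le> u"
  shows "(1 + 1 / k) ^ J \<le> 1 + 17 / 256 * \<epsilon>"
proof -
  have k: "0 < k" using assms by (smt (verit) divide_pos_pos)
  have "(1 + 1 / k) ^ J \<le> exp (1 / k) ^ J"
    using k exp_ge_add_one_self[of "1 / k"] by (intro power_mono) auto
  also have "\<dots> = exp (real J / k)" by (simp flip: exp_of_nat_mult)
  also have "\<dots> \<le> exp (\<epsilon> / 16)"
  proof (intro iffD2[OF exp_le_cancel_iff])
    have "real J * 16 \<le> \<epsilon> * k" using assms by (simp add: field_simps)
    then show "real J / k \<le> \<epsilon> / 16" using k by (simp add: field_simps)
  qed
  also have "\<dots> \<le> 1 + \<epsilon> / 16 + (\<epsilon> / 16)\<^sup>2" using assms by (intro exp_bound) auto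
  also have "(\<epsilon> / 16)\<^sup>2 \<le> \<epsilon> / 256" using assms by (simp add: power2_eq_square field_simps mult_left_le)
  finally show ?thesis by simp
qed

lemma req_k_facts:
  assumes "0 < \<epsilon>" "\<epsilon> \<le> 1" "0 < log 2 (ln (1 / \<delta>))"
  shows "16 * log 2 (ln (1 / \<delta>)) / \<epsilon> \<le> real (req_k \<epsilon> \<delta>)" "even (req_k \<epsilon> \<delta>)" "16 \<le> req_k \<epsilon> \<delta>"
    "real (req_k \<epsilon> \<delta>) \<le> 16 * (log 2 (ln (1 / \<delta>)) / \<epsilon> + 1)"
proof -
  define X where "X = log 2 (ln (1 / \<delta>)) / \<epsilon>"
  have "0 < X" using assms by (simp add: X_def)
  then have c: "0 < \<lceil>X\<rceil>" by simp
  then have rk: "real (req_k \<epsilon> \<delta>) = 16 * real_of_int \<lceil>X\<rceil>"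
    by (simp add: req_k_def X_def)
  have "16 * X \<le> real (req_k \<epsilon> \<delta>)" unfolding rk by linarith
  then show "16 * log 2 (ln (1 / \<delta>)) / \<epsilon> \<le> real (req_k \<epsilon> \<delta>)" by (simp add: X_def)
  have "real (req_k \<epsilon> \<delta>) \<le> 16 * (X + 1)"
    unfolding rk by (intro mult_left_mono of_int_ceiling_le_add_one) simp
  then show "real (req_k \<epsilon> \<delta>) \<le> 16 * (log 2 (ln (1 / \<delta>)) / \<epsilon> + 1)"
    unfolding X_def .
  show "even (req_k \<epsilon> \<delta>)" by (simp add: req_k_def)
  have "0 < nat \<lceil>X\<rceil>" using c by simp
  moreover have "req_k \<epsilon> \<delta> = 16 * nat \<lceil>X\<rceil>" by (simp add: req_k_def X_def)
  ultimately show "16 \<le> req_k \<epsilon> \<delta>" by linarith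
qed

section \<open>Probability and memory\<close>

lemma req_error_probability:
  fixes xs :: "'a::linorder list" and \<delta> \<epsilon> :: real
  assumes \<delta>: "0 < \<delta>" and \<epsilon>: "0 < \<epsilon>" "\<epsilon> \<le> 1" and len: "length xs \<le> n"
    and rank: "0 < item_rank xs y"
  shows "measure_pmf.prob (req_sketch (req_k \<epsilon> \<delta>) n xs)
    {s. \<epsilon> * real (item_rank xs y) \<le> \<bar>Err xs y s\<bar>} < 3 * \<delta>"
proof (cases "\<delta> \<le> 1 / 3")
  case False
  then have "1 < 3 * \<delta>" by simp
  then show ?thesis using measure_pmf.prob_le_1 order_le_less_trans by blast
next
  case True
  define v where "v = ln (1 / \<delta>)"
  define u where "u = log 2 v"
  define k where "k = req_k \<epsilon> \<delta>"
  define J where "J = nat \<lfloor>u\<rfloor>"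
  have "3 \<le> 1 / \<delta>" using True \<delta> by (simp add: field_simps)
  then have v: "549 / 500 \<le> v" using ln_3_ge ln_mono[of 3 "1 / \<delta>"] by (simp add: v_def)
  then have u: "0 < u" by (simp add: u_def)
  have J: "real J \<le> u" using u by (simp add: J_def)
  have k: "16 * u / \<epsilon> \<le> real k" "even k" "16 \<le> k"
    using req_k_facts[of \<epsilon> \<delta>] \<epsilon> u by (auto simp: k_def u_def v_def)
  have exp_v: "exp (- v) = \<delta>" using \<delta> by (simp add: v_def ln_div)
  let ?S = "{x. \<epsilon> * real (item_rank xs y) \<le> \<bar>x\<bar>}"
  have "measure_pmf.prob (errs k n y xs) ?S < 3 * \<delta>"
  proof -
    have zero: ?thesis if "\<And>x. x \<in> set_pmf (errs k n y xs) \<Longrightarrow> x = 0"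
    proof -
      have "0 < \<epsilon> * real (item_rank xs y)" using rank \<epsilon> by simp
      then have "set_pmf (errs k n y xs) \<inter> ?S = {}" by (auto dest: that)
      then have "measure_pmf.prob (errs k n y xs) ?S = 0" by (simp add: measure_pmf_zero_iff)
      then show ?thesis using \<delta> by simp
    qed
    have "0 < k" using k by simp
    then show ?thesis using k(2)
    proof (cases rule: capacity_cases[of k n])
      case 1
      then show ?thesis using errs_no_output zero by blast
    next
      case (2 m)
      interpret compactor_params k n m by fact
      show ?thesis
      proof (cases "3 \<le> m")
        case False
        \<comment> \<open>For these m, 2^m = 2 m, so the level 0 buffer can hold all n
          items.\<close>
        then have "m = 1 \<or> m = 2" using m_pos by auto
        then have "k * 2 ^ m = 2 * k * m" by auto
        then have "length xs \<le> 2 * k * m" using len n_le by linarith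
        then have "int (length xs) \<le> int (2 * k * m)" by (simp only: of_nat_le_iff)
        then have "int (length xs) \<le> capacity k n" using capacity by simp
        then show ?thesis using errs_no_output zero by blast
      next
        case True
        have "v - 2 / 5 \<le> 178 / 1000 * (16 * u)\<^sup>2 * 2 ^ J"
          unfolding u_def J_def by (rule exponent_bound[OF v])
        also have "\<dots> \<le> 178 / 1000 * (\<epsilon> * real k)\<^sup>2 * 2 ^ J"
          using k(1) \<epsilon> u by (intro mult_right_mono mult_left_mono power_mono) (auto simp: field_simps)
        finally have E: "- (178 / 1000 * (\<epsilon> * real k)\<^sup>2 * 2 ^ J) \<le> 2 / 5 - v" by simp
        have "measure_pmf.prob (errs k n y xs) ?S \<le> 2 * exp (- (178 / 1000 * (\<epsilon> * real k)\<^sup>2 * 2 ^ J))"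
          using errs_prob[OF len \<epsilon> rank _ True] one_plus_inverse_power_le[OF \<epsilon> u k(1) J] by blast
        also have "\<dots> \<le> 2 * exp (2 / 5 - v)" using E by simp
        also have "exp (2 / 5 - v) = exp (2 / 5) * exp (- v)" by (simp flip: exp_add)
        also have "2 * (exp (2 / 5) * exp (- v)) = 2 * exp (2 / 5) * \<delta>" unfolding exp_v by simp
        also have "\<dots> < 3 * \<delta>" using exp_two_fifths_less \<delta> by simp
        finally show ?thesis .
      qed
    qed
  qed
  then show ?thesis by (simp add: errs_def k_def vimage_def)
qed

lemma req_error_rank_zero:
  assumes "item_rank xs y = 0" "s \<in> set_pmf (req_sketch k n xs)"
  shows "Err xs y s = 0"
  using errs_rank_zero[OF assms(1), of "Err xs y s" k n] assms(2) by (simp add: errs_def)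

section \<open>Counters, number of levels and memory\<close>

lemma compactor_insert_state:
  assumes "(c', out) \<in> set_pmf (compactor_insert k n x c)"
  shows "fst c' \<le> Suc (fst c)"
proof (cases c)
  case (Pair C b)
  then show ?thesis using assms
    by (auto simp: compactor_insert_simps compact_def Let_def split: if_splits)
qed

lemma compactor_feed_state:
  "(c', out) \<in> set_pmf (compactor_feed k n xs c) \<Longrightarrow> fst c' \<le> fst c + length xs"
proof (induction xs arbitrary: c c' out)
  case (Cons x xs)
  then obtain c1 o1 o2 where
    1: "(c1, o1) \<in> set_pmf (compactor_insert k n x c)" and
    2: "(c', o2) \<in> set_pmf (compactor_feed k n xs c1)"
    by (fastforce split: prod.splits)
  show ?case using Cons.IH[OF 2] compactor_insert_state[OF 1] by simp
qed simp

lemma sketch_feed_fresh_cases: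
  assumes "s \<in> set_pmf (sketch_feed k n xs [])"
  obtains "xs = []" "s = []"
  | c out cs where "xs \<noteq> []" "s = c # cs"
      "(c, out) \<in> set_pmf (compactor_feed k n xs empty_compactor)"
      "cs \<in> set_pmf (sketch_feed k n out [])" "length out < length xs"
proof (cases "xs = []")
  case False
  then obtain c out cs where *: "s = c # cs"
      "(c, out) \<in> set_pmf (compactor_feed k n xs empty_compactor)"
      "cs \<in> set_pmf (sketch_feed k n out [])"
    using assms by (auto simp: sketch_feed_fresh)
  have "length out < length xs"
    using compactor_feed_size[OF *(2)] False by (auto simp: empty_compactor_def nonempty_has_size)
  then show ?thesis using that(2) False * by blast
qed (use assms that(1) in simp)

lemma sketch_feed_state:
  "s \<in> set_pmf (sketch_feed k n xs []) \<Longrightarrow> c \<in> set s \<Longrightarrow> fst c \<le> length xs"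
proof (induction "length xs" arbitrary: xs s rule: less_induct)
  case less
  from less.prems(1) show ?case
  proof (cases rule: sketch_feed_fresh_cases)
    case (2 c' out cs)
    then show ?thesis
      using less.hyps[OF 2(5,4)] compactor_feed_state[OF 2(3)] less.prems(2)
      by (fastforce simp: empty_compactor_def)
  qed (use less.prems in simp)
qed

text \<open>Ensures that each counter fits into one word.\<close>

lemma req_sketch_state:
  assumes "s \<in> set_pmf (req_sketch k n xs)" "c \<in> set s"
  shows "fst c \<le> length xs"
  using assms sketch_feed_state[of s k n xs c]
  by (auto simp: req_sketch_eq empty_compactor_def split: if_splits)

text \<open>A level outputs at most half as many items as it receives, and it creates the next level
  only after receiving more than 2 k m \<ge> 2 k items.\<close>

lemma (in compactor_params) sketch_feed_levels:
  "length xs \<le> n \<Longrightarrow> s \<in> set_pmf (sketch_feed k n xs []) \<Longrightarrow>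
    (\<forall>c\<in>set s. size (snd c) \<le> 2 * k * m) \<and> (length s \<le> 1 \<or> 2 ^ (length s - 1) * k \<le> length xs)"
proof (induction "length xs" arbitrary: xs s rule: less_induct)
  case less
  from less.prems(2) show ?case
  proof (cases rule: sketch_feed_fresh_cases)
    case (2 c out cs)
    note F = feed_empty[OF less.prems(1) 2(3)]
    have IH: "(\<forall>c\<in>set cs. size (snd c) \<le> 2 * k * m) \<and> (length cs \<le> 1 \<or> 2 ^ (length cs - 1) * k \<le> length out)"
      using less.hyps[OF 2(5) _ 2(4)] 2(5) less.prems(1) by simp
    have "length s \<le> 1 \<or> 2 ^ (length s - 1) * k \<le> length xs"
    proof (cases "cs = []")
      case False
      then have "out \<noteq> []" using 2(4) by auto
      then have big: "2 * k * m < length xs" using F(3) by force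
      have "2 * k \<le> 2 * k * m" using m_pos by simp
      then have k_le: "2 * k \<le> length xs" using big by linarith
      have pow: "2 ^ length cs * k = 2 * (2 ^ (length cs - 1) * k)"
        using False by (cases cs) auto
      show ?thesis
      proof (cases "length cs = 1")
        case True
        then show ?thesis using k_le 2(2) by simp
      next
        case False
        then have "2 ^ (length cs - 1) * k \<le> length out" using IH \<open>cs \<noteq> []\<close> by (auto simp: le_Suc_eq)
        then have "2 ^ length cs * k \<le> length xs" using pow F(1) by linarith
        then show ?thesis using 2(2) by simp
      qed
    qed (use 2(2) in simp)
    then show ?thesis using IH F(2) 2(2) by simp
  qed simp
qed

lemma (in compactor_params) req_sketch_memory:
  assumes "length xs \<le> n" "s \<in> set_pmf (req_sketch k n xs)" "k < n"
  shows "real (memory_words k n s) \<le> 2 + (1 + log 2 (real n / real k)) * (1 + 2 * real k * real m)"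
proof -
  define g where "g = log 2 (real n / real k)"
  have g: "0 \<le> g" using assms(3) k_pos unfolding g_def by (subst zero_le_log_cancel_iff) auto
  have *: "(\<forall>c\<in>set s. size (snd c) \<le> 2 * k * m) \<and> (length s \<le> 1 \<or> 2 ^ (length s - 1) * k \<le> length xs)"
    using sketch_feed_levels[OF assms(1)] assms(2) by (auto simp: req_sketch_eq empty_compactor_def split: if_splits)
  have ell: "real (length s) \<le> 1 + g"
  proof (cases "length s \<le> 1")
    case False
    then have "2 ^ (length s - 1) * k \<le> n" using * assms(1) by linarith
    then have "real (2 ^ (length s - 1) * k) \<le> real n" by (simp only: of_nat_le_iff)
    then have "2 ^ (length s - 1) \<le> real n / real k" using k_pos by (simp add: field_simps)
    then have "real (length s - 1) \<le> g"
      using assms(3) k_pos unfolding g_def by (subst le_log_iff) (auto simp: powr_realpow)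
    then show ?thesis by linarith
  qed (use g in linarith)
  have "nat (max (capacity k n) (int (size b))) = 2 * k * m" if "(C, b) \<in> set s" for C b
  proof -
    have "size b \<le> 2 * k * m" using * that by auto
    then have "int (size b) \<le> int (2 * k * m)" by (simp only: of_nat_le_iff)
    then have "max (capacity k n) (int (size b)) = int (2 * k * m)" using capacity by simp
    then show ?thesis by (simp only: nat_int)
  qed
  then have "(\<Sum>(C, b)\<leftarrow>s. 1 + nat (max (capacity k n) (int (size b)))) = (\<Sum>c\<leftarrow>s. 1 + 2 * k * m)"
    by (intro arg_cong[where f = sum_list] map_cong) auto
  then have "memory_words k n s = 2 + length s * (1 + 2 * k * m)"
    by (simp add: memory_words_def sum_list_triv)
  then have "real (memory_words k n s) = 2 + real (length s) * (1 + 2 * real k * real m)"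
    by (simp add: distrib_left)
  also have "\<dots> \<le> 2 + (1 + g) * (1 + 2 * real k * real m)"
    using ell by (intro add_left_mono mult_right_mono) auto
  finally show ?thesis by (simp add: g_def)
qed

text \<open>Level 0 simply stores the stream: two words for the parameters, one for the counter, one
  per item.\<close>

lemma req_sketch_memory_small:
  assumes "capacity k n \<le> 0" "s \<in> set_pmf (req_sketch k n xs)"
  shows "memory_words k n s = 3 + length xs"
proof (cases "xs = []")
  case True
  then show ?thesis using assms by (simp add: req_sketch_eq memory_words_def empty_compactor_def)
next
  case False
  then have "s \<in> set_pmf (sketch_feed k n xs [])" using assms(2) by (simp add: req_sketch_eq)
  then show ?thesis
  proof (cases rule: sketch_feed_fresh_cases)
    case (2 c out cs)
    have "out = [] \<and> snd c = mset xs"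
      using compactor_feed_no_output[OF _ 2(3)] assms(1) by (simp add: empty_compactor_def)
    then show ?thesis using 2(2,4) assms(1) by (cases c) (simp add: memory_words_def)
  qed (use False in simp)
qed

lemma two_plus_sq_le_powr:
  fixes l :: real
  assumes "0 \<le> l"
  shows "(2 + l)\<^sup>2 \<le> 9 * 2 powr l"
proof -
  have "(2 + l)\<^sup>2 \<le> (3 * (1 + l / 3))\<^sup>2" using assms by (intro power_mono) auto
  also have "\<dots> = 9 * (1 + l / 3)\<^sup>2" unfolding power_mult_distrib by simp
  also have "\<dots> \<le> 9 * (exp (l / 3))\<^sup>2"
    using assms exp_ge_add_one_self[of "l / 3"] by (intro mult_left_mono power_mono) auto
  also have "(exp (l / 3))\<^sup>2 = exp (l * (2 / 3))" by (simp flip: exp_of_nat_mult)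
  also have "\<dots> \<le> exp (l * ln 2)"
    using assms ln2_ge_two_thirds by (intro iffD2[OF exp_le_cancel_iff] mult_left_mono)
  finally show ?thesis by (simp add: powr_def mult.commute)
qed

text \<open>Replaces log2 (n / k) by log2 (\<epsilon> n). If \<epsilon> k < 1, the former can be
  larger by l = - log2 (\<epsilon> k); then k itself is smaller than 1 / \<epsilon> by the factor
  2^l, which outweighs the quadratic (2 + l)^2.\<close>

lemma memory_arith:
  fixes k n \<epsilon> w :: real
  assumes \<epsilon>: "0 < \<epsilon>" and k: "0 < k" "k < n" "k \<le> 48 * (w / \<epsilon>)" and w: "1 / 2 \<le> w"
  shows "k * (1 + log 2 (n / k))\<^sup>2 \<le> 200 * (1 / \<epsilon> * (max 1 (log 2 (\<epsilon> * n)))\<^sup>2 * w)"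
proof -
  define A where "A = max 1 (log 2 (\<epsilon> * n))"
  define l where "l = - log 2 (\<epsilon> * k)"
  define g where "g = log 2 (n / k)"
  have A: "1 \<le> A" "log 2 (\<epsilon> * n) \<le> A" by (auto simp: A_def)
  have g: "0 \<le> g" using k unfolding g_def by (subst zero_le_log_cancel_iff) auto
  have "log 2 (\<epsilon> * n) = g + log 2 (\<epsilon> * k)"
    using k \<epsilon> by (simp add: g_def log_mult log_divide)
  then have g_le: "g \<le> A + l" using A by (simp add: l_def)
  have "k * (1 + g)\<^sup>2 \<le> 200 * (A\<^sup>2 * (w / \<epsilon>))"
  proof (cases "0 \<le> l")
    case False
    then have "(1 + g)\<^sup>2 \<le> (2 * A)\<^sup>2" using g g_le A by (intro power_mono) auto
    then have "k * (1 + g)\<^sup>2 \<le> (48 * (w / \<epsilon>)) * (2 * A)\<^sup>2" using k by (intro mult_mono) auto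
    also have "\<dots> = 192 * (A\<^sup>2 * (w / \<epsilon>))" by (simp add: power_mult_distrib)
    also have "\<dots> \<le> 200 * (A\<^sup>2 * (w / \<epsilon>))" using w \<epsilon> by (intro mult_right_mono) auto
    finally show ?thesis .
  next
    case True
    have "1 + g \<le> 1 + A + l" using g_le by simp
    also have "\<dots> \<le> A * (2 + l)" using A mult_right_mono[OF A(1) True] by (simp add: algebra_simps)
    finally have "(1 + g)\<^sup>2 \<le> (A * (2 + l))\<^sup>2" using g by (intro power_mono) auto
    also have "\<dots> \<le> A\<^sup>2 * (9 * 2 powr l)"
      unfolding power_mult_distrib by (intro mult_left_mono two_plus_sq_le_powr True) auto
    also have "2 powr l = 1 / (\<epsilon> * k)" using \<epsilon> k by (simp add: l_def powr_minus field_simps)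
    finally have "k * (1 + g)\<^sup>2 \<le> k * (A\<^sup>2 * (9 * (1 / (\<epsilon> * k))))" using k by (intro mult_left_mono) auto
    also have "\<dots> = 18 * (A\<^sup>2 * ((1 / 2) / \<epsilon>))" using k by simp
    also have "\<dots> \<le> 18 * (A\<^sup>2 * (w / \<epsilon>))"
      using w \<epsilon> by (intro mult_left_mono divide_right_mono) auto
    also have "\<dots> \<le> 200 * (A\<^sup>2 * (w / \<epsilon>))" using w \<epsilon> by (intro mult_right_mono) auto
    finally show ?thesis .
  qed
  then show ?thesis by (simp add: A_def g_def mult_ac)
qed

lemma req_memory_bound:
  fixes xs :: "'a::linorder list" and \<delta> \<epsilon> :: real
  assumes \<delta>: "0 < \<delta>" "\<delta> \<le> 1 / 2" and \<epsilon>: "0 < \<epsilon>" "\<epsilon> \<le> 1" and len: "length xs \<le> n"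
    and kpos: "0 < req_k \<epsilon> \<delta>" and s: "s \<in> set_pmf (req_sketch (req_k \<epsilon> \<delta>) n xs)"
  shows "real (memory_words (req_k \<epsilon> \<delta>) n s)
    \<le> 1000 * (1 / \<epsilon> * (max 1 (log 2 (\<epsilon> * real n)))\<^sup>2 * log 2 (log 2 (1 / \<delta>)))"
proof -
  define v where "v = ln (1 / \<delta>)"
  define u where "u = log 2 v"
  define k where "k = req_k \<epsilon> \<delta>"
  define w where "w = log 2 (log 2 (1 / \<delta>))"
  define A where "A = max 1 (log 2 (\<epsilon> * real n))"
  have "0 < \<lceil>1 / \<epsilon> * u\<rceil>" using kpos by (simp add: req_k_def u_def v_def)
  then have "0 < 1 / \<epsilon> * u" by simp
  then have u: "0 < u" using \<epsilon> by (simp add: zero_less_divide_iff)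
  have v: "0 < v" using \<delta> by (simp add: v_def ln_gt_zero)
  have k: "even k" "16 \<le> k" "real k \<le> 16 * (u / \<epsilon> + 1)"
    using req_k_facts[of \<epsilon> \<delta>] \<epsilon> u by (auto simp: k_def u_def v_def)
  have "log 2 (1 / \<delta>) = v * (1 / ln 2)" by (simp add: log_def v_def)
  then have w_eq: "w = u + log 2 (1 / ln 2)"
    using v unfolding w_def u_def by (simp only:) (subst log_mult, auto)
  \<comment> \<open>The value u can be arbitrarily close to 0 while k is at least 16. The base 2
    logarithm inside w adds a positive constant, which absorbs the rounding up in k.\<close>
  have "1 / 2 \<le> log 2 (36 / 25 :: real)" using log2_ge[of "36 / 25"] by simp
  also have "\<dots> \<le> log 2 (1 / ln 2)"
    using ln2_le_25_over_36 by (subst log_le_cancel_iff) (auto simp: field_simps)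
  finally have w: "1 / 2 \<le> w" "u \<le> w" using w_eq u by linarith+
  have k_le: "real k \<le> 48 * (w / \<epsilon>)"
  proof -
    have "u / \<epsilon> \<le> w / \<epsilon>" using w \<epsilon> by (intro divide_right_mono) auto
    moreover have "1 \<le> 2 * (w / \<epsilon>)" using w \<epsilon> by (simp add: field_simps)
    ultimately have "16 * (u / \<epsilon> + 1) \<le> 16 * (3 * (w / \<epsilon>))" by (intro mult_left_mono) linarith+
    then show ?thesis using k(3) by simp
  qed
  have A: "1 \<le> A\<^sup>2" by (simp add: A_def)
  have "0 < k" using k by simp
  then have "real (memory_words k n s) \<le> 1000 * (1 / \<epsilon> * A\<^sup>2 * w)" using k(1)
  proof (cases rule: capacity_cases[of k n])
    case 1
    have "memory_words k n s = 3 + length xs" using req_sketch_memory_small 1(1) s k_def by blast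
    also have "\<dots> \<le> 2 * k" using len 1(2) k by simp
    finally have "real (memory_words k n s) \<le> 2 * real k" by simp
    also have "\<dots> \<le> 1000 * (w / \<epsilon>) * 1" using k_le by simp
    also have "\<dots> \<le> 1000 * (w / \<epsilon>) * A\<^sup>2" using A w \<epsilon> by (intro mult_left_mono) auto
    finally show ?thesis by (simp add: mult_ac)
  next
    case (2 m)
    interpret compactor_params k n m by fact
    define g where "g = log 2 (real n / real k)"
    have g: "0 \<le> g" using 2(2) k_pos unfolding g_def by (subst zero_le_log_cancel_iff) auto
    have k1: "1 \<le> real k" using k_pos by simp
    have "1 + 2 * real k * real m \<le> 3 * (real k * (1 + g))"
    proof -
      have "real k * real m \<le> real k * (1 + g)" using 2(3) by (intro mult_left_mono) (auto simp: g_def)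
      moreover have "1 * 1 \<le> real k * (1 + g)" using k1 g by (intro mult_mono) auto
      ultimately show ?thesis by linarith
    qed
    then have "(1 + g) * (1 + 2 * real k * real m) \<le> (1 + g) * (3 * (real k * (1 + g)))"
      using g by (intro mult_left_mono) auto
    moreover have "1 * 1 \<le> real k * (1 + g)\<^sup>2" using k1 g by (intro mult_mono) auto
    moreover have "real (memory_words k n s) \<le> 2 + (1 + g) * (1 + 2 * real k * real m)"
      unfolding g_def using req_sketch_memory len s 2(2) k_def by blast
    ultimately have "real (memory_words k n s) \<le> 5 * (real k * (1 + g)\<^sup>2)"
      by (simp add: power2_eq_square algebra_simps)
    also have "\<dots> \<le> 5 * (200 * (1 / \<epsilon> * A\<^sup>2 * w))"
      unfolding g_def A_def using \<epsilon> k_pos 2(2) k_le w by (intro mult_left_mono memory_arith) auto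
    finally show ?thesis by simp
  qed
  then show ?thesis by (simp add: k_def A_def w_def)
qed

theorem theorem6:
  "(\<forall>(\<delta>::real) (\<epsilon>::real) (n::nat) (xs :: 'a::linorder list) y.
      0 < \<delta> \<and> \<delta> \<le> 1/2 \<and> 0 < \<epsilon> \<and> \<epsilon> \<le> 1 \<and> length xs \<le> n \<longrightarrow>
        (item_rank xs y > 0 \<longrightarrow>
          measure_pmf.prob (req_sketch (req_k \<epsilon> \<delta>) n xs)
            {s. \<bar>Err xs y s\<bar> \<ge> \<epsilon> * real (item_rank xs y)} < 3 * \<delta>) \<and>
        (item_rank xs y = 0 \<longrightarrow>
          (\<forall>s \<in> set_pmf (req_sketch (req_k \<epsilon> \<delta>) n xs). Err xs y s = 0)))
   \<and>
   (\<exists>K::real. K > 0 \<and>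
     (\<forall>(\<delta>::real) (\<epsilon>::real) (n::nat) (xs :: 'a list).
        0 < \<delta> \<and> \<delta> \<le> 1/2 \<and> 0 < \<epsilon> \<and> \<epsilon> \<le> 1 \<and> length xs \<le> n \<and> req_k \<epsilon> \<delta> > 0 \<longrightarrow>
          (\<forall>s \<in> set_pmf (req_sketch (req_k \<epsilon> \<delta>) n xs).
             real (memory_words (req_k \<epsilon> \<delta>) n s)
               \<le> K * (1 / \<epsilon> * (max 1 (log 2 (\<epsilon> * real n)))\<^sup>2 * log 2 (log 2 (1 / \<delta>))) \<and>
             (\<forall>(C, b) \<in> set s. C \<le> n))))"
proof (intro conjI exI[of _ 1000] allI impI ballI)
  show "measure_pmf.prob (req_sketch (req_k \<epsilon> \<delta>) n xs)
      {s. \<bar>Err xs y s\<bar> \<ge> \<epsilon> * real (item_rank xs y)} < 3 * \<delta>"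
    if "0 < \<delta> \<and> \<delta> \<le> 1/2 \<and> 0 < \<epsilon> \<and> \<epsilon> \<le> 1 \<and> length xs \<le> n" "item_rank xs y > 0"
    for \<delta> \<epsilon> n and xs :: "'a list" and y
    using that by (intro req_error_probability) auto
  show "Err xs y s = 0"
    if "item_rank xs y = 0" "s \<in> set_pmf (req_sketch (req_k \<epsilon> \<delta>) n xs)"
    for \<delta> \<epsilon> n and xs :: "'a list" and y s
    using that by (rule req_error_rank_zero)
  show "real (memory_words (req_k \<epsilon> \<delta>) n s)
      \<le> 1000 * (1 / \<epsilon> * (max 1 (log 2 (\<epsilon> * real n)))\<^sup>2 * log 2 (log 2 (1 / \<delta>)))"
    if "0 < \<delta> \<and> \<delta> \<le> 1/2 \<and> 0 < \<epsilon> \<and> \<epsilon> \<le> 1 \<and> length xs \<le> n \<and> req_k \<epsilon> \<delta> > 0"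
      "s \<in> set_pmf (req_sketch (req_k \<epsilon> \<delta>) n xs)"
    for \<delta> \<epsilon> n and xs :: "'a list" and s
    using that by (intro req_memory_bound) auto
  show "case c of (C, b) \<Rightarrow> C \<le> n"
    if "0 < \<delta> \<and> \<delta> \<le> 1/2 \<and> 0 < \<epsilon> \<and> \<epsilon> \<le> 1 \<and> length xs \<le> n \<and> req_k \<epsilon> \<delta> > 0"
      "s \<in> set_pmf (req_sketch (req_k \<epsilon> \<delta>) n xs)" "c \<in> set s"
    for \<delta> \<epsilon> n and xs :: "'a list" and s c
    using req_sketch_state[OF that(2,3)] that(1) by (cases c) auto
qed simp

end
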